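(* Let $\{S_j\}_{j\in\mathbf{N}}$ be an infinite sequence of contractive similarities of $\mathbf{R}^d$, $S_j(x)=\rho_jR_jx+b_j$ with $0<\rho_j<1$, $b_j\in\mathbf{R}^d$, $R_j$ orthogonal, satisfying the strong open set condition with open set $O$. Let $P_j>0$ with $\sum_{j=1}^\infty P_j=1$, and let $\mu$ be the corresponding infinite self-similar measure. Suppose the equation $\sum_{j=1}^\infty P_j^2\rho_j^{-\beta}=1$ has a finite solution $\beta$. For $j\neq k$ let $d_{jk}>0$ be the distance between $S_j(O)$ and $S_k(O)$, and assume $$\sum_{j\ne k}P_jP_kd_{jk}^{-\beta}<\infty .$$ For $\lambda>0$ let $q(\lambda)=\sum_{j:\,\rho_j\le\lambda}P_j^2\rho_j^{-\beta}$, and assume there are $0<\varepsilon<1$ and $0<\delta<1$ such that $q(\varepsilon\lambda)\le\delta\,q(\lambda)$ for all $0<\lambda\le1$. Then there is a function $P:(0,\infty)\to(0,\infty)$ such that $$\lim_{t\to0^+}\bigl(V_\beta(t;\mu)-P(t)\bigr)=0$$ and the following holds. (i) If $\{-\ln\rho_j: j\in\mathbf{N}\}$ is non-arithmetic, then $P(t)=c'$ for all $t$, for some constant $c'$. (ii) Otherwise, let $(\ln\rho)\mathbf{Z}$, $\rho>1$, be the lattice (additive subgroup of $\mathbf{R}$) generated by $\{-\ln\rho_j:j\in\mathbf{N}\}$; then $P(\rho t)=P(t)$ for all $t>0$.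
   Context: Infinite self-similar set: the unique nonempty compact set $K\subset\mathbf{R}^d$ with $K=\overline{\bigcup_{j=1}^\infty S_j(K)}$. Strong open set condition: there exists a bounded open set $O\subset\mathbf{R}^d$ such that $S_j(O)\subset O$ for all $j$, $S_i(O)\cap S_j(O)=\emptyset$ for $i\ne j$, the sets $S_j(\overline{O})$ are mutually disjoint, and $O\cap K\ne\emptyset$. Infinite self-similar measure with weights $(P_j)$: the unique Borel probability measure $\mu$ on $\mathbf{R}^d$ with $\mu(A)=\sum_{j=1}^\infty P_j\,\mu(S_j^{-1}(A))$ for all Borel sets $A$; its support is $K$. For $0\le\alpha\le d$ and $t>0$, $$V_\alpha(t;\mu)=\frac{1}{t^{d+\alpha}}\int_{\mathbf{R}^d}|\mu(B_t(x))|^2\,dx,$$ where $B_t(x)$ is the ball of radius $t$ centered at $x$. A set of real numbers is arithmetic if it is contained in $c\mathbf{Z}$ for some $c>0$, and non-arithmetic otherwise. *)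

theory Defs
  imports "HOL-Probability.Probability" "HOL-Computational_Algebra.Group_Closure"
begin

text \<open>The self-similar set and the self-similar measure of an infinite sequence of maps are
  described by predicates: for the systems considered here each of them is satisfied by exactly one
  object, and a statement about all objects satisfying the predicate is a statement about that one.\<close>

definition is_self_similar_set ::
    "(nat \<Rightarrow> 'a \<Rightarrow> 'a) \<Rightarrow> 'a::topological_space set \<Rightarrow> bool" where
  "is_self_similar_set S K \<longleftrightarrow> compact K \<and> K \<noteq> {} \<and> K = closure (\<Union>j. S j ` K)"

definition is_self_similar_measure ::
    "(nat \<Rightarrow> 'a \<Rightarrow> 'a) \<Rightarrow> (nat \<Rightarrow> real) \<Rightarrow> 'a::topological_space measure \<Rightarrow> bool" where
  "is_self_similar_measure S p M \<longleftrightarrow>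
     prob_space M \<and> sets M = sets borel \<and>
     (\<forall>A\<in>sets borel. (\<lambda>j. p j * measure M (S j -` A)) sums measure M A)"

definition strong_open_set_condition ::
    "(nat \<Rightarrow> 'a \<Rightarrow> 'a) \<Rightarrow> 'a::metric_space set \<Rightarrow> 'a set \<Rightarrow> bool" where
  "strong_open_set_condition S K U \<longleftrightarrow>
     bounded U \<and> open U \<and>
     (\<forall>j. S j ` U \<subseteq> U) \<and>
     (\<forall>i j. i \<noteq> j \<longrightarrow> S i ` U \<inter> S j ` U = {}) \<and>
     (\<forall>i j. i \<noteq> j \<longrightarrow> S i ` closure U \<inter> S j ` closure U = {}) \<and>
     U \<inter> K \<noteq> {}"

definition V :: "real \<Rightarrow> real \<Rightarrow> (real ^ 'n) measure \<Rightarrow> real" where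
  "V \<alpha> t M = 1 / t powr (real CARD('n) + \<alpha>) * (\<integral>x. \<bar>measure M (ball x t)\<bar>\<^sup>2 \<partial>lborel)"

definition arithmetic :: "real set \<Rightarrow> bool" where
  "arithmetic A \<longleftrightarrow> (\<exists>c>0. A \<subseteq> range (\<lambda>m::int. c * of_int m))"

end

theory Submission
  imports Defs
begin

text \<open>Put \<open>v(u) = V \<beta> (exp (-u)) \<mu>\<close>, \<open>m j = (p j)\<^sup>2 \<rho> j powr (-\<beta>)\<close> and
  \<open>a j = - ln (\<rho> j)\<close>. Inserting the self-similarity of \<open>\<mu>\<close> twice into \<open>V\<close> gives the renewal
  equation \<open>v(u) = (\<Sum>j. m j * v (u - a j)) + e(u)\<close>, where \<open>e\<close> collects the pairs \<open>j \<noteq> k\<close>; such a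
  pair only contributes when \<open>S j ` U\<close> and \<open>S k ` U\<close> are closer than \<open>2 * exp (-u)\<close>, so the summability
  hypothesis makes \<open>e\<close> integrable. A Choquet--Deny argument shows \<open>v(u) - v(u - s) \<rightarrow> 0\<close> for every \<open>s\<close> in
  the group generated by the steps \<open>a j\<close>, and, \<open>exp (-(d + \<beta>) u) * v(u)\<close> being monotone, for every real
  \<open>s\<close> if that group is dense. Integrating the renewal equation against a measure \<open>\<nu>\<close> invariant under
  the steps then gives
  \<open>\<Sum>j. m j * (\<integral>s\<in>{0..<a j}. v (u - s) \<partial>\<nu>) = \<integral>s\<in>{0..}. e (u - s) \<partial>\<nu>\<close>, whose left-hand side is
  asymptotically a multiple of \<open>v(u)\<close>, and whose right-hand side is asymptotically \<open>\<integral>s. e (u - s) \<partial>\<nu>\<close>,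
  which is periodic under all translations that preserve \<open>\<nu>\<close>. The mean of the steps is finite by the
  condition on \<open>q\<close>.\<close>

section \<open>Subgroups of the reals and the Choquet--Deny argument\<close>

text \<open>If the positive elements stay above some \<open>\<eta> > 0\<close>, their infimum
  \<open>h\<close> is attained, since otherwise two elements just above it would differ by less than
  \<open>\<eta>\<close>. Dividing by \<open>h\<close> leaves a remainder that lies in
  \<open>H\<close> and is smaller than \<open>h\<close>, so it vanishes.\<close>

lemma real_subgroup_cases:
  fixes H :: "real set"
  assumes zero: "0 \<in> H" and diff: "\<And>x y. x \<in> H \<Longrightarrow> y \<in> H \<Longrightarrow> x - y \<in> H"
    and pos: "\<exists>a\<in>H. 0 < a"
  obtains (cyclic) h where "0 < h" "H = range (\<lambda>n::int. h * of_int n)"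
  | (dense) "\<And>\<eta>. 0 < \<eta> \<Longrightarrow> \<exists>g\<in>H. 0 < g \<and> g < \<eta>"
proof (cases "\<forall>\<eta>>0. \<exists>g\<in>H. 0 < g \<and> g < \<eta>")
  case True
  then show thesis using dense by blast
next
  case False
  then obtain \<eta> where \<eta>: "0 < \<eta>" "\<And>g. g \<in> H \<Longrightarrow> 0 < g \<Longrightarrow> \<eta> \<le> g"
    by (meson not_less)
  define H' where "H' = {g\<in>H. 0 < g}"
  define h where "h = Inf H'"
  have ne: "H' \<noteq> {}" using pos by (auto simp: H'_def)
  have bdd: "bdd_below H'" by (rule bdd_belowI[of _ 0]) (auto simp: H'_def)
  have "\<eta> \<le> h" unfolding h_def using ne \<eta>(2) by (intro cInf_greatest) (auto simp: H'_def)
  with \<eta> have "0 < h" by simp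
  have lower: "h \<le> g" if "g \<in> H" "0 < g" for g
    unfolding h_def using that bdd by (intro cInf_lower) (auto simp: H'_def)
  have "h \<in> H"
  proof (rule ccontr)
    assume "h \<notin> H"
    have "\<exists>g\<in>H'. g < h + \<eta>"
      using cInf_less_iff[OF ne bdd, of "h + \<eta>"] \<open>0 < \<eta>\<close> by (simp add: h_def[symmetric])
    then obtain g where g: "g \<in> H" "0 < g" "g < h + \<eta>" by (auto simp: H'_def)
    with lower \<open>h \<notin> H\<close> have "h < g" by (metis order_le_less)
    then have "\<exists>g'\<in>H'. g' < g" using cInf_less_iff[OF ne bdd] by (simp add: h_def[symmetric])
    then obtain g' where g': "g' \<in> H" "0 < g'" "g' < g" by (auto simp: H'_def)
    with lower have "h \<le> g'" by blast
    then have "g - g' \<in> H" "0 < g - g'" "g - g' < \<eta>" using g g' diff by auto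
    then show False using \<eta>(2) by fastforce
  qed
  have uminus: "- x \<in> H" if "x \<in> H" for x using diff[OF zero that] by simp
  have add: "x + y \<in> H" if "x \<in> H" "y \<in> H" for x y using diff[OF that(1) uminus[OF that(2)]] by simp
  have multnat: "h * of_nat n \<in> H" for n
    by (induction n) (auto simp: zero algebra_simps intro: add \<open>h \<in> H\<close>)
  have mult: "h * of_int n \<in> H" for n
    using multnat uminus[OF multnat] by (cases n rule: int_cases2) auto
  have "x \<in> range (\<lambda>n::int. h * of_int n)" if "x \<in> H" for x
  proof -
    define n where "n = \<lfloor>x / h\<rfloor>"
    have "of_int n \<le> x / h" "x / h < of_int n + 1" by (auto simp: n_def)
    with \<open>0 < h\<close> have "h * of_int n \<le> x" "x < h * of_int n + h"
      by (auto simp: field_simps)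
    moreover have "x - h * of_int n \<in> H" using that mult diff by blast
    ultimately have "x = h * of_int n" using lower[of "x - h * of_int n"] by fastforce
    then show ?thesis by auto
  qed
  with mult have "H = range (\<lambda>n::int. h * of_int n)" by auto
  with \<open>0 < h\<close> show thesis by (rule cyclic)
qed

lemma filterlim_minus_const_at_top: "filterlim (\<lambda>u. u - x) at_top at_top" for x :: real
  using filterlim_tendsto_add_at_top[OF tendsto_const[of "-x"] filterlim_ident] by simp

text \<open>A form of the Choquet--Deny argument without compactness: along a sequence realising the limes
  superior \<open>L\<close> of the increments over \<open>a i\<close>, all earlier increments tend to \<open>L\<close> as well, and
  telescoping contradicts boundedness unless \<open>L \<le> 0\<close>.\<close>

lemma renewal_increment_le:
  fixes m a :: "nat \<Rightarrow> real" and v e :: "real \<Rightarrow> real"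
  assumes m_pos: "\<And>j. 0 < m j" and m_sums: "m sums 1"
    and bounded: "\<And>u. \<bar>v u\<bar> \<le> M"
    and eq: "\<And>u. (\<lambda>j. m j * v (u - a j)) sums (v u - e u)"
    and e_lim: "(e \<longlongrightarrow> 0) at_top" and "0 < \<eta>"
  shows "\<forall>\<^sub>F u in at_top. v u - v (u - a i) \<le> \<eta>"
proof -
  define D where "D u = v u - v (u - a i)" for u
  define E where "E u = e u - e (u - a i)" for u
  have D_le: "\<bar>D u\<bar> \<le> 2 * M" for u
    using bounded[of u] bounded[of "u - a i"] by (auto simp: D_def)
  have M: "0 \<le> M" using bounded[of 0] by linarith
  have eqD: "(\<lambda>j. m j * D (u - a j)) sums (D u - E u)" for u
    using sums_diff[OF eq[of u] eq[of "u - a i"]]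
    by (simp add: D_def E_def algebra_simps)
  have E_lim: "(E \<longlongrightarrow> 0) at_top"
    unfolding E_def
    using tendsto_diff[OF e_lim filterlim_compose[OF e_lim filterlim_minus_const_at_top[of "a i"]]] by simp
  \<comment> \<open>\<open>X\<close> collects the eventual upper bounds of \<open>D\<close>, so its
    infimum \<open>L\<close> is the limes superior of \<open>D\<close> at infinity.\<close>
  define X where "X = {x. \<forall>\<^sub>F u in at_top. D u \<le> x}"
  define L where "L = Inf X"
  have D_le': "D u \<le> 2 * M" "- 2 * M \<le> D u" for u using D_le[of u] by linarith+
  have ne: "X \<noteq> {}" using D_le'(1) by (auto simp: X_def intro!: exI[of _ "2 * M"])
  have X_ge: "- 2 * M \<le> x" if "x \<in> X" for x
  proof -
    have "\<exists>u. D u \<le> x"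
      using that unfolding X_def mem_Collect_eq by (intro eventually_happens'[of at_top]) auto
    then show ?thesis using D_le'(2) order_trans by blast
  qed
  have bdd: "bdd_below X" by (rule bdd_belowI) (rule X_ge)
  have upper: "\<forall>\<^sub>F u in at_top. D u \<le> y" if less: "L < y" for y
  proof -
    obtain x where "x \<in> X" "x < y" using less cInf_less_iff[OF ne bdd, of y] by (auto simp: L_def)
    then have "\<forall>\<^sub>F u in at_top. D u \<le> x" by (simp add: X_def)
    then show ?thesis by eventually_elim (use \<open>x < y\<close> in simp)
  qed
  have lower: "\<exists>u\<ge>x. y < D u" if "y < L" for x y
  proof (rule ccontr)
    assume "\<not> ?thesis"
    then have "\<forall>u\<ge>x. D u \<le> y" by (auto simp: not_less)
    then have "y \<in> X" by (auto simp: X_def eventually_at_top_linorder)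
    then have "L \<le> y" unfolding L_def by (intro cInf_lower bdd)
    with that show False by simp
  qed
  have L_le: "\<bar>L\<bar> \<le> 2 * M"
    using cInf_greatest[OF ne X_ge] cInf_lower[OF _ bdd, of "2 * M"] D_le'
    by (auto simp: L_def X_def)
  \<comment> \<open>The averaged excess of the earlier increments over \<open>L\<close>; it tends to
    \<open>0\<close> by dominated convergence for series.\<close>
  define r where "r u = (\<Sum>j. m j * max 0 (D (u - a j) - L))" for u
  have summ: "summable (\<lambda>j. m j * (4 * M))" using m_sums by (intro summable_mult2) (simp add: sums_iff)
  have pos_le: "max 0 (D u - L) \<le> 4 * M" for u using D_le[of u] L_le M by auto
  have norm_le: "norm (m j * max 0 (D (u - a j) - L)) \<le> m j * (4 * M)" for j u
    using pos_le[of "u - a j"] m_pos[of j] by (auto simp: abs_mult intro!: mult_left_mono)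
  have pos_lim: "((\<lambda>u. max 0 (D u - L)) \<longlongrightarrow> 0) at_top"
  proof (rule order_tendstoI)
    fix y :: real assume "y < 0"
    then show "\<forall>\<^sub>F u in at_top. y < max 0 (D u - L)" by (auto simp: less_max_iff_disj)
  next
    fix y :: real assume "0 < y"
    then have "\<forall>\<^sub>F u in at_top. D u \<le> L + y / 2" by (intro upper) simp
    then show "\<forall>\<^sub>F u in at_top. max 0 (D u - L) < y" by eventually_elim (use \<open>0 < y\<close> in \<open>auto simp: field_simps\<close>)
  qed
  have r_lim: "(r \<longlongrightarrow> 0) at_top"
  proof -
    have "((\<lambda>u. \<Sum>j. m j * max 0 (D (u - a j) - L)) \<longlongrightarrow> (\<Sum>j::nat. 0)) at_top"
    proof (rule tannerys_theorem[THEN conjunct2, THEN conjunct2])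
      show "((\<lambda>u. m j * max 0 (D (u - a j) - L)) \<longlongrightarrow> 0) at_top" for j
        using tendsto_mult_left[OF filterlim_compose[OF pos_lim filterlim_minus_const_at_top[of "a j"]], of "m j"] by simp
      show "\<forall>\<^sub>F (j, u) in sequentially \<times>\<^sub>F at_top. norm (m j * max 0 (D (u - a j) - L)) \<le> m j * (4 * M)"
        using norm_le by (intro always_eventually) auto
    qed (use summ in auto)
    then show ?thesis by (simp add: r_def[abs_def])
  qed
  \<comment> \<open>Adding the excess \<open>r u\<close> to the average of
    \<open>L - D (u - a j)\<close> turns every summand into a positive part, so the single summand
    for \<open>i\<close> is at most the whole sum.\<close>
  have ineq: "m i * (L - D (u - a i)) \<le> L - D u + E u + r u" for u
  proof -
    have s1: "(\<lambda>j. m j * L - m j * D (u - a j)) sums (L - (D u - E u))"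
      using sums_diff[OF sums_mult2[OF m_sums, of L] eqD[of u]] by simp
    have "(\<lambda>j. m j * max 0 (D (u - a j) - L)) sums r u"
      unfolding r_def by (rule summable_sums, rule summable_comparison_test'[OF summ, of 0]) (rule norm_le)
    from sums_add[OF s1 this]
    have "(\<lambda>j. m j * L - m j * D (u - a j) + m j * max 0 (D (u - a j) - L)) sums (L - D u + E u + r u)"
      by (simp add: algebra_simps)
    also have "(\<lambda>j. m j * L - m j * D (u - a j) + m j * max 0 (D (u - a j) - L))
        = (\<lambda>j. m j * max 0 (L - D (u - a j)))"
      by (auto simp: max_def algebra_simps)
    finally have s2: "(\<lambda>j. m j * max 0 (L - D (u - a j))) sums (L - D u + E u + r u)" .
    have "m i * (L - D (u - a i)) \<le> m i * max 0 (L - D (u - a i))"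
      using m_pos[of i] by (intro mult_left_mono) auto
    also have "\<dots> = (\<Sum>j\<in>{i}. m j * max 0 (L - D (u - a j)))" by simp
    also have "\<dots> \<le> (\<Sum>j. m j * max 0 (L - D (u - a j)))"
      using s2 by (intro sum_le_suminf) (auto simp: sums_iff less_imp_le[OF m_pos])
    also have "\<dots> = L - D u + E u + r u" using s2 by (simp add: sums_iff)
    finally show ?thesis .
  qed
  \<comment> \<open>Near-maximal increments propagate backwards: \<open>ineq\<close> bounds
    \<open>D (u' n - a i)\<close> from below, and the vanishing excess over \<open>L\<close> bounds
    it from above.\<close>
  have step: "((\<lambda>n. D (u' n - a i)) \<longlongrightarrow> L) sequentially"
    if u': "filterlim u' at_top sequentially" and "((\<lambda>n. D (u' n)) \<longlongrightarrow> L) sequentially" for u' :: "nat \<Rightarrow> real"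
  proof (rule tendsto_sandwich)
    have "(\<lambda>n. L - (L - D (u' n) + E (u' n) + r (u' n)) / m i) \<longlonglongrightarrow> L - (L - L + 0 + 0) / m i"
      using m_pos[of i] by (intro tendsto_intros that filterlim_compose[OF E_lim] filterlim_compose[OF r_lim]) auto
    then show "(\<lambda>n. L - (L - D (u' n) + E (u' n) + r (u' n)) / m i) \<longlonglongrightarrow> L" by simp
    have "filterlim (\<lambda>n. u' n - a i) at_top sequentially"
      by (rule filterlim_compose[OF filterlim_minus_const_at_top u'])
    then have "(\<lambda>n. L + max 0 (D (u' n - a i) - L)) \<longlonglongrightarrow> L + 0"
      by (intro tendsto_intros filterlim_compose[OF pos_lim])
    then show "(\<lambda>n. L + max 0 (D (u' n - a i) - L)) \<longlonglongrightarrow> L" by simp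
    show "\<forall>\<^sub>F n in sequentially. L - (L - D (u' n) + E (u' n) + r (u' n)) / m i \<le> D (u' n - a i)"
      using ineq m_pos[of i] by (intro always_eventually) (simp add: field_simps)
  qed (auto simp: max_def)
  have "L \<le> 0"
  proof (rule ccontr)
    assume "\<not> L \<le> 0"
    have "\<exists>u\<ge>real n. L - 1 / real (Suc n) < D u" for n by (intro lower) simp
    then obtain U where U: "\<And>n. real n \<le> U n" "\<And>n. L - 1 / real (Suc n) < D (U n)" by metis
    have U_lim: "filterlim U at_top sequentially"
      by (rule filterlim_at_top_mono[OF filterlim_real_sequentially]) (use U in auto)
    have base: "(\<lambda>n. D (U n)) \<longlonglongrightarrow> L"
    proof (rule tendsto_sandwich)
      have "(\<lambda>n. L - 1 / real (Suc n)) \<longlonglongrightarrow> L - 0"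
        by (intro tendsto_intros LIMSEQ_Suc[OF lim_1_over_n])
      then show "(\<lambda>n. L - 1 / real (Suc n)) \<longlonglongrightarrow> L" by simp
      have "(\<lambda>n. L + max 0 (D (U n) - L)) \<longlonglongrightarrow> L + 0"
        by (intro tendsto_intros filterlim_compose[OF pos_lim U_lim])
      then show "(\<lambda>n. L + max 0 (D (U n) - L)) \<longlonglongrightarrow> L" by simp
      show "\<forall>\<^sub>F n in sequentially. L - 1 / real (Suc n) \<le> D (U n)"
        by (intro always_eventually allI less_imp_le U(2))
    qed (auto simp: max_def)
    have shifted: "filterlim (\<lambda>n. U n - real k * a i) at_top sequentially" for k
      by (rule filterlim_compose[OF filterlim_minus_const_at_top U_lim])
    have D_lim: "(\<lambda>n. D (U n - real k * a i)) \<longlonglongrightarrow> L" for k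
    proof (induction k)
      case (Suc k)
      from step[OF shifted Suc] show ?case by (simp add: algebra_simps)
    qed (use base in simp)
    have "real N * L \<le> 2 * M" for N
    proof (rule tendsto_upperbound)
      show "(\<lambda>n. \<Sum>k<N. D (U n - real k * a i)) \<longlonglongrightarrow> real N * L"
        using tendsto_sum[of "{..<N}", OF D_lim] by simp
      have "(\<Sum>k<N. D (w - real k * a i)) = v w - v (w - real N * a i)" for w
        by (induction N) (auto simp: D_def algebra_simps)
      moreover have "v w - v w' \<le> 2 * M" for w w' using bounded[of w] bounded[of w'] by linarith
      ultimately show "\<forall>\<^sub>F n in sequentially. (\<Sum>k<N. D (U n - real k * a i)) \<le> 2 * M" by simp
    qed simp
    moreover obtain N where "2 * M < real N * L"
      using reals_Archimedean3[of L] \<open>\<not> L \<le> 0\<close> by (metis not_le)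
    ultimately show False by (meson not_le)
  qed
  with \<open>0 < \<eta>\<close> have "L < \<eta>" by simp
  from upper[OF this] show ?thesis by (simp add: D_def)
qed

text \<open>The equation is linear, so the one-sided estimate applies to both \<open>v\<close> and
  \<open>- v\<close>.\<close>

lemma renewal_increment_tendsto:
  fixes m a :: "nat \<Rightarrow> real" and v e :: "real \<Rightarrow> real"
  assumes m_pos: "\<And>j. 0 < m j" and m_sums: "m sums 1"
    and bounded: "\<And>u. \<bar>v u\<bar> \<le> M"
    and eq: "\<And>u. (\<lambda>j. m j * v (u - a j)) sums (v u - e u)"
    and e_lim: "(e \<longlongrightarrow> 0) at_top"
  shows "((\<lambda>u. v u - v (u - a i)) \<longlongrightarrow> 0) at_top"
proof (rule tendstoI)
  fix \<eta> :: real assume "0 < \<eta>"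
  then have "0 < \<eta> / 2" by simp
  have "(\<lambda>j. m j * (- v (u - a j))) sums (- v u - (- e u))" for u
    using sums_minus[OF eq[of u]] by simp
  moreover have "((\<lambda>u. - e u) \<longlongrightarrow> 0) at_top" using tendsto_minus[OF e_lim] by simp
  ultimately have "\<forall>\<^sub>F u in at_top. - v u - (- v (u - a i)) \<le> \<eta> / 2"
    using \<open>0 < \<eta> / 2\<close> bounded by (intro renewal_increment_le[OF m_pos m_sums]) auto
  moreover have "\<forall>\<^sub>F u in at_top. v u - v (u - a i) \<le> \<eta> / 2"
    using renewal_increment_le[OF m_pos m_sums bounded eq e_lim \<open>0 < \<eta> / 2\<close>] .
  ultimately show "\<forall>\<^sub>F u in at_top. dist (v u - v (u - a i)) 0 < \<eta>"
    by eventually_elim (use \<open>0 < \<eta>\<close> in \<open>auto simp: abs_less_iff\<close>)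
qed

section \<open>The renewal theorem\<close>

text \<open>\<open>v_shift\<close> says that \<open>exp (- \<gamma> * u) * v u\<close> is
  nonincreasing and stands in for continuity of \<open>v\<close>. In the application the index of
  \<open>c\<close> and \<open>\<tau>\<close> enumerates pairs of maps, each contributing to the
  error only while \<open>u < \<tau> i\<close>.\<close>

locale renewal_equation =
  fixes m a :: "nat \<Rightarrow> real" and v e :: "real \<Rightarrow> real" and c \<tau> :: "nat \<Rightarrow> real"
    and \<beta> \<gamma> C :: real
  assumes m_pos: "\<And>j. 0 < m j" and m_sums: "m sums 1"
    and a_pos: "\<And>j. 0 < a j" and mean: "summable (\<lambda>j. m j * a j)"
    and beta_pos: "0 < \<beta>" and gamma_nonneg: "0 \<le> \<gamma>"
    and v_pos: "\<And>u. 0 < v u" and v_measurable [measurable]: "v \<in> borel_measurable borel"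
    and v_le: "\<And>u. v u \<le> C * exp (\<beta> * u)"
    and v_shift: "\<And>s u. 0 \<le> s \<Longrightarrow> exp (- \<gamma> * s) * v u \<le> v (u - s)"
    and v_eq: "\<And>u. (\<lambda>j. m j * v (u - a j)) sums (v u - e u)"
    and e_nonneg: "\<And>u. 0 \<le> e u"
    and c_nonneg: "\<And>i. 0 \<le> c i" and c_summable: "summable (\<lambda>i. c i * exp (\<beta> * \<tau> i))"
    and e_le: "\<And>u. e u \<le> (\<Sum>i. if u < \<tau> i then c i * exp (\<beta> * u) else 0)"

text \<open>\<open>\<nu>\<close> is Lebesgue measure in the non-arithmetic case and counting measure on the lattice
  generated by the steps in the arithmetic case.\<close>

locale renewal_equation_measure = renewal_equation m a v e c \<tau> \<beta> \<gamma> C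
  for m a v e c \<tau> \<beta> \<gamma> C +
  fixes \<nu> :: "real measure" and \<kappa> B :: real
  assumes sets_nu [measurable_cong]: "sets \<nu> = sets borel"
    and nu_shift: "\<And>j. distr \<nu> borel (\<lambda>s. s + a j) = \<nu>"
    and kappa_pos: "0 < \<kappa>" and nu_period: "\<And>j. emeasure \<nu> {0..<a j} = ennreal (\<kappa> * a j)"
    and B_nonneg: "0 \<le> B"
    and nu_tail: "\<And>x. (\<integral>\<^sup>+s. ennreal (exp (- \<beta> * s)) * indicator {x..} s \<partial>\<nu>) \<le> ennreal (B * exp (- \<beta> * x))"
begin

section \<open>Elementary bounds and decay of the error term\<close>

lemma v_nonneg: "0 \<le> v u" using v_pos[of u] by simp

lemma C_nonneg: "0 \<le> C"
proof -
  have "0 < C * exp (\<beta> * 0)" using v_pos v_le by (rule less_le_trans)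
  then show ?thesis by simp
qed

lemma space_nu [simp]: "space \<nu> = UNIV"
  using sets_eq_imp_space_eq[OF sets_nu] by simp

lemma e_eq: "e u = v u - (\<Sum>j. m j * v (u - a j))"
  using v_eq[of u] by (simp add: sums_iff)

lemma e_measurable [measurable]: "e \<in> borel_measurable borel"
  unfolding e_eq[abs_def] by measurable

lemma summable_c: "summable (\<lambda>i. if u < \<tau> i then c i * exp (\<beta> * u) else 0)"
proof (rule summable_comparison_test'[OF c_summable, of 0])
  show "norm (if u < \<tau> i then c i * exp (\<beta> * u) else 0) \<le> c i * exp (\<beta> * \<tau> i)" for i
    using beta_pos c_nonneg[of i] by (auto intro!: mult_left_mono)
qed

text \<open>Each summand is \<open>0\<close> once \<open>u\<close> has passed
  \<open>\<tau> i\<close>, and all are dominated by the series in \<open>c_summable\<close>.\<close>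

lemma tail_tendsto: "((\<lambda>u. \<Sum>i. if u < \<tau> i then c i * exp (\<beta> * \<tau> i) else 0) \<longlongrightarrow> 0) at_top"
proof -
  have "((\<lambda>u. \<Sum>i. if u < \<tau> i then c i * exp (\<beta> * \<tau> i) else 0) \<longlongrightarrow> (\<Sum>i::nat. 0)) at_top"
  proof (rule tannerys_theorem[THEN conjunct2, THEN conjunct2, OF _ _ c_summable])
    show "((\<lambda>u. if u < \<tau> i then c i * exp (\<beta> * \<tau> i) else 0) \<longlongrightarrow> 0) at_top" for i
      by (rule tendsto_eventually) (use eventually_ge_at_top[of "\<tau> i"] in eventually_elim, simp)
    show "\<forall>\<^sub>F (i, u) in sequentially \<times>\<^sub>F at_top.
        norm (if u < \<tau> i then c i * exp (\<beta> * \<tau> i) else 0) \<le> c i * exp (\<beta> * \<tau> i)"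
      using c_nonneg by (intro always_eventually) auto
  qed simp
  then show ?thesis by simp
qed

lemma summable_tail: "summable (\<lambda>i. if u < \<tau> i then c i * exp (\<beta> * \<tau> i) else 0)"
  by (rule summable_comparison_test'[OF c_summable, of 0]) (use c_nonneg in auto)

text \<open>A summand is present only when \<open>u < \<tau> i\<close>, and then
  \<open>exp (\<beta> * u)\<close> is at most \<open>exp (\<beta> * \<tau> i)\<close>.\<close>

lemma e_tendsto: "(e \<longlongrightarrow> 0) at_top"
proof (rule tendsto_sandwich[OF _ _ tendsto_const tail_tendsto])
  have "e u \<le> (\<Sum>i. if u < \<tau> i then c i * exp (\<beta> * \<tau> i) else 0)" for u
  proof (rule order_trans[OF e_le suminf_le[OF _ summable_c summable_tail]])
    show "(if u < \<tau> i then c i * exp (\<beta> * u) else 0) \<le> (if u < \<tau> i then c i * exp (\<beta> * \<tau> i) else 0)" for i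
      using beta_pos c_nonneg[of i] by (auto intro!: mult_left_mono)
  qed
  then show "\<forall>\<^sub>F u in at_top. e u \<le> (\<Sum>i. if u < \<tau> i then c i * exp (\<beta> * \<tau> i) else 0)"
    by simp
qed (simp add: e_nonneg)

lemma nn_integral_shift:
  assumes [measurable]: "f \<in> borel_measurable borel" and x: "distr \<nu> borel (\<lambda>s. s + x) = \<nu>"
  shows "(\<integral>\<^sup>+s. f (s + x) \<partial>\<nu>) = (\<integral>\<^sup>+s. f s \<partial>\<nu>)"
proof -
  have "(\<integral>\<^sup>+s. f s \<partial>\<nu>) = (\<integral>\<^sup>+s. f s \<partial>distr \<nu> borel (\<lambda>s. s + x))" using x by simp
  also have "\<dots> = (\<integral>\<^sup>+s. f (s + x) \<partial>\<nu>)" by (rule nn_integral_distr) measurable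
  finally show ?thesis by simp
qed

section \<open>The renewal equation integrated against the invariant measure\<close>

definition Z :: "nat \<Rightarrow> real \<Rightarrow> ennreal" where
  "Z j u = (\<integral>\<^sup>+s. ennreal (v (u - s)) * indicator {0..<a j} s \<partial>\<nu>)"

definition T_pos :: "real \<Rightarrow> ennreal" where
  "T_pos u = (\<integral>\<^sup>+s. ennreal (e (u - s)) * indicator {0..} s \<partial>\<nu>)"

text \<open>Integrating over the whole line instead of the past makes the result exactly invariant
  under every translation that preserves \<open>\<nu>\<close>; up to a constant this is the
  limit.\<close>

definition T :: "real \<Rightarrow> ennreal" where
  "T u = (\<integral>\<^sup>+s. ennreal (e (u - s)) \<partial>\<nu>)"

text \<open>Integrating the renewal equation over the past \<open>s \<ge> 0\<close> and cancelling, by invariance of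
  \<open>\<nu>\<close>, what both sides have in common.\<close>

lemma sum_Z: "(\<Sum>j. ennreal (m j) * Z j u) = T_pos u"
proof -
  \<comment> \<open>The integral of \<open>v\<close> over the whole past. It is finite because
    \<open>v_le\<close> gives decay at rate \<open>exp (- \<beta> * s)\<close>, and finiteness is
    what permits the cancellation at the end.\<close>
  define W where "W = (\<integral>\<^sup>+s. ennreal (v (u - s)) * indicator {0..} s \<partial>\<nu>)"
  define R where "R j = (\<integral>\<^sup>+s. ennreal (v (u - s)) * indicator {a j..} s \<partial>\<nu>)" for j
  have W_split: "W = Z j u + R j" for j
    unfolding W_def Z_def R_def
    by (subst nn_integral_add[symmetric])
       (use a_pos[of j] in \<open>auto intro!: nn_integral_cong simp: indicator_def\<close>)
  \<comment> \<open>Invariance of \<open>\<nu>\<close> turns the part of the past beyond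
    \<open>a j\<close> into the integral of the \<open>j\<close>-th shifted term of the renewal
    equation.\<close>
  have R_shift: "R j = (\<integral>\<^sup>+s. ennreal (v (u - s - a j)) * indicator {0..} s \<partial>\<nu>)" for j
  proof -
    have "R j = (\<integral>\<^sup>+s. ennreal (v (u - (s + a j))) * indicator {a j..} (s + a j) \<partial>\<nu>)"
      unfolding R_def by (rule nn_integral_shift[OF _ nu_shift, symmetric]) measurable
    also have "\<dots> = (\<integral>\<^sup>+s. ennreal (v (u - s - a j)) * indicator {0..} s \<partial>\<nu>)"
      by (intro nn_integral_cong) (auto simp: indicator_def algebra_simps)
    finally show ?thesis .
  qed
  have "W \<le> (\<integral>\<^sup>+s. ennreal (C * exp (\<beta> * u)) * (ennreal (exp (- \<beta> * s)) * indicator {0..} s) \<partial>\<nu>)"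
    unfolding W_def
  proof (intro nn_integral_mono)
    fix s
    have "v (u - s) \<le> C * exp (\<beta> * u) * exp (- \<beta> * s)"
      using v_le[of "u - s"] by (simp add: right_diff_distrib exp_diff exp_minus divide_inverse mult.assoc)
    then show "ennreal (v (u - s)) * indicator {0..} s
        \<le> ennreal (C * exp (\<beta> * u)) * (ennreal (exp (- \<beta> * s)) * indicator {0..} s)"
      using C_nonneg by (auto simp: indicator_def ennreal_mult[symmetric] intro!: ennreal_leI)
  qed
  also have "\<dots> = ennreal (C * exp (\<beta> * u)) * (\<integral>\<^sup>+s. ennreal (exp (- \<beta> * s)) * indicator {0..} s \<partial>\<nu>)"
    by (rule nn_integral_cmult) measurable
  also have "\<dots> \<le> ennreal (C * exp (\<beta> * u)) * ennreal (B * exp (- \<beta> * 0))"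
    by (intro mult_left_mono nu_tail) simp
  also have "\<dots> < \<infinity>" by (simp add: ennreal_mult_less_top)
  finally have W_fin: "W < \<infinity>" .
  have m_ennreal: "(\<Sum>j. ennreal (m j)) = 1"
    by (subst suminf_ennreal_eq[OF _ m_sums]) (auto intro: less_imp_le m_pos)
  have v_ennreal: "ennreal (v w) = (\<Sum>j. ennreal (m j) * ennreal (v (w - a j))) + ennreal (e w)" for w
  proof -
    have nonneg: "0 \<le> m j * v (w - a j)" for j
      using m_pos[of j] v_nonneg by simp
    have "0 \<le> v w - e w" by (rule sums_le[OF _ sums_zero v_eq]) (rule nonneg)
    then have "ennreal (v w) = ennreal (v w - e w) + ennreal (e w)"
      using e_nonneg[of w] by (subst ennreal_plus[symmetric]) auto
    also have "ennreal (v w - e w) = (\<Sum>j. ennreal (m j * v (w - a j)))"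
      by (rule suminf_ennreal_eq[OF nonneg v_eq, symmetric])
    also have "\<dots> = (\<Sum>j. ennreal (m j) * ennreal (v (w - a j)))"
      by (intro suminf_cong ennreal_mult less_imp_le[OF m_pos] v_nonneg)
    finally show ?thesis .
  qed
  have "W = (\<integral>\<^sup>+s. (\<Sum>j. ennreal (m j) * (ennreal (v (u - s - a j)) * indicator {0..} s))
      + ennreal (e (u - s)) * indicator {0..} s \<partial>\<nu>)"
    unfolding W_def
    by (intro nn_integral_cong, subst v_ennreal) (auto simp: indicator_def)
  also have "\<dots> = (\<integral>\<^sup>+s. (\<Sum>j. ennreal (m j) * (ennreal (v (u - s - a j)) * indicator {0..} s)) \<partial>\<nu>) + T_pos u"
    unfolding T_pos_def by (rule nn_integral_add) measurable
  also have "(\<integral>\<^sup>+s. (\<Sum>j. ennreal (m j) * (ennreal (v (u - s - a j)) * indicator {0..} s)) \<partial>\<nu>)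
      = (\<Sum>j. \<integral>\<^sup>+s. ennreal (m j) * (ennreal (v (u - s - a j)) * indicator {0..} s) \<partial>\<nu>)"
    by (rule nn_integral_suminf) measurable
  also have "\<dots> = (\<Sum>j. ennreal (m j) * R j)"
    unfolding R_shift by (intro suminf_cong nn_integral_cmult) measurable
  finally have W1: "W = (\<Sum>j. ennreal (m j) * R j) + T_pos u" .
  have "W = (\<Sum>j. ennreal (m j) * W)" using m_ennreal by simp
  also have "\<dots> = (\<Sum>j. ennreal (m j) * R j + ennreal (m j) * Z j u)"
    by (intro suminf_cong, subst W_split) (simp add: distrib_left add.commute)
  also have "\<dots> = (\<Sum>j. ennreal (m j) * R j) + (\<Sum>j. ennreal (m j) * Z j u)"
    by (rule suminf_add[symmetric]) auto
  finally have W2: "W = (\<Sum>j. ennreal (m j) * R j) + (\<Sum>j. ennreal (m j) * Z j u)" .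
  have "(\<Sum>j. ennreal (m j) * R j) + (\<Sum>j. ennreal (m j) * Z j u)
      = (\<Sum>j. ennreal (m j) * R j) + T_pos u"
    unfolding W2[symmetric] by (rule W1)
  moreover have "(\<Sum>j. ennreal (m j) * R j) \<noteq> \<infinity>"
  proof -
    have "(\<Sum>j. ennreal (m j) * R j) \<le> W" using W1 by simp
    with W_fin show ?thesis by (auto simp: top_unique)
  qed
  ultimately show ?thesis by (simp add: ennreal_add_left_cancel)
qed

text \<open>After exchanging sum and integral, the \<open>i\<close>-th term lives on
  \<open>s > u - \<tau> i\<close>, where \<open>nu_tail\<close> bounds its integral by a quantity
  free of \<open>u\<close>. The condition on \<open>A\<close> discards the terms that vanish
  throughout \<open>A\<close>.\<close>

lemma nn_integral_e_le:
  assumes [measurable]: "A \<in> sets borel"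
  shows "(\<integral>\<^sup>+s. ennreal (e (u - s)) * indicator A s \<partial>\<nu>)
    \<le> (\<Sum>i. if \<exists>s\<in>A. u - s < \<tau> i then ennreal (B * (c i * exp (\<beta> * \<tau> i))) else 0)"
proof -
  define f where "f i s = (if u - s < \<tau> i then c i * exp (\<beta> * (u - s)) else 0)" for i s
  have f_nonneg: "0 \<le> f i s" for i s using c_nonneg by (simp add: f_def)
  have [measurable]: "f i \<in> borel_measurable borel" for i unfolding f_def by measurable
  have "(\<integral>\<^sup>+s. ennreal (e (u - s)) * indicator A s \<partial>\<nu>) \<le> (\<integral>\<^sup>+s. (\<Sum>i. ennreal (f i s) * indicator A s) \<partial>\<nu>)"
  proof (rule nn_integral_mono)
    fix s
    have "ennreal (e (u - s)) \<le> ennreal (\<Sum>i. f i s)"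
      using e_le[of "u - s"] by (intro ennreal_leI) (simp add: f_def)
    also have "\<dots> = (\<Sum>i. ennreal (f i s))"
      using summable_c[of "u - s"] f_nonneg by (intro suminf_ennreal2[symmetric]) (auto simp: f_def)
    finally show "ennreal (e (u - s)) * indicator A s \<le> (\<Sum>i. ennreal (f i s) * indicator A s)"
      by (auto simp: indicator_def)
  qed
  also have "\<dots> = (\<Sum>i. \<integral>\<^sup>+s. ennreal (f i s) * indicator A s \<partial>\<nu>)"
    by (rule nn_integral_suminf) measurable
  also have "\<dots> \<le> (\<Sum>i. if \<exists>s\<in>A. u - s < \<tau> i then ennreal (B * (c i * exp (\<beta> * \<tau> i))) else 0)"
  proof (rule suminf_le)
    fix i
    show "(\<integral>\<^sup>+s. ennreal (f i s) * indicator A s \<partial>\<nu>)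
      \<le> (if \<exists>s\<in>A. u - s < \<tau> i then ennreal (B * (c i * exp (\<beta> * \<tau> i))) else 0)"
    proof (cases "\<exists>s\<in>A. u - s < \<tau> i")
      case True
      have "(\<integral>\<^sup>+s. ennreal (f i s) * indicator A s \<partial>\<nu>)
        \<le> (\<integral>\<^sup>+s. ennreal (c i * exp (\<beta> * u)) * (ennreal (exp (- \<beta> * s)) * indicator {u - \<tau> i..} s) \<partial>\<nu>)"
      proof (rule nn_integral_mono)
        fix s
        have "ennreal (c i * exp (\<beta> * (u - s))) = ennreal (c i * exp (\<beta> * u)) * ennreal (exp (- \<beta> * s))"
          using c_nonneg[of i] by (simp add: ennreal_mult[symmetric] right_diff_distrib exp_diff exp_minus divide_inverse)
        then show "ennreal (f i s) * indicator A s
            \<le> ennreal (c i * exp (\<beta> * u)) * (ennreal (exp (- \<beta> * s)) * indicator {u - \<tau> i..} s)"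
          by (auto simp: f_def indicator_def)
      qed
      also have "\<dots> = ennreal (c i * exp (\<beta> * u)) * (\<integral>\<^sup>+s. ennreal (exp (- \<beta> * s)) * indicator {u - \<tau> i..} s \<partial>\<nu>)"
        by (rule nn_integral_cmult) measurable
      also have "\<dots> \<le> ennreal (c i * exp (\<beta> * u)) * ennreal (B * exp (- \<beta> * (u - \<tau> i)))"
        by (intro mult_left_mono nu_tail) simp
      also have "\<dots> = ennreal (B * (c i * exp (\<beta> * \<tau> i)))"
      proof -
        have "c i * exp (\<beta> * u) * (B * exp (- \<beta> * (u - \<tau> i))) = B * (c i * exp (\<beta> * \<tau> i))"
          by (simp add: exp_add[symmetric] right_diff_distrib)
        then show ?thesis using c_nonneg[of i] B_nonneg by (simp add: ennreal_mult[symmetric])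
      qed
      finally show ?thesis using True by simp
    next
      case False
      then have "(\<integral>\<^sup>+s. ennreal (f i s) * indicator A s \<partial>\<nu>) = (\<integral>\<^sup>+s. 0 \<partial>\<nu>)"
        by (intro nn_integral_cong) (auto simp: f_def indicator_def)
      with False show ?thesis by simp
    qed
  qed auto
  finally show ?thesis .
qed

definition B_total :: real where "B_total = (\<Sum>i. B * (c i * exp (\<beta> * \<tau> i)))"

lemma T_le: "T u \<le> ennreal B_total"
proof -
  have "T u = (\<integral>\<^sup>+s. ennreal (e (u - s)) * indicator UNIV s \<partial>\<nu>)" by (simp add: T_def)
  also have "\<dots> \<le> (\<Sum>i. if \<exists>s\<in>UNIV. u - s < \<tau> i then ennreal (B * (c i * exp (\<beta> * \<tau> i))) else 0)"
    by (rule nn_integral_e_le) simp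
  also have "\<dots> \<le> (\<Sum>i. ennreal (B * (c i * exp (\<beta> * \<tau> i))))"
    by (rule suminf_le) auto
  also have "\<dots> = ennreal B_total"
    unfolding B_total_def
    using c_summable B_nonneg c_nonneg by (intro suminf_ennreal2) (auto intro: summable_mult)
  finally show ?thesis .
qed

lemma T_split: "T u = T_pos u + (\<integral>\<^sup>+s. ennreal (e (u - s)) * indicator {..<0} s \<partial>\<nu>)"
  unfolding T_def T_pos_def
  by (subst nn_integral_add[symmetric]) (auto intro!: nn_integral_cong simp: indicator_def)

lemma T_pos_le: "T_pos u \<le> T u" unfolding T_split by simp

text \<open>The difference is the integral over \<open>s < 0\<close>. There
  \<open>u - s < \<tau> i\<close> forces \<open>u < \<tau> i\<close>, so only a tail of the series
  in \<open>c_summable\<close> remains.\<close>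

lemma T_minus_T_pos_tendsto: "((\<lambda>u. enn2real (T u) - enn2real (T_pos u)) \<longlongrightarrow> 0) at_top"
proof (rule tendsto_sandwich[OF _ _ tendsto_const])
  let ?r = "\<lambda>u. B * (\<Sum>i. if u < \<tau> i then c i * exp (\<beta> * \<tau> i) else 0)"
  show "(?r \<longlongrightarrow> 0) at_top" using tendsto_mult_left[OF tail_tendsto, of B] by simp
  have fin: "T u < \<infinity>" for u using T_le[of u] by (simp add: le_less_trans)
  then have fin': "T_pos u < \<infinity>" for u using T_pos_le[of u] by (simp add: le_less_trans)
  show "\<forall>\<^sub>F u in at_top. 0 \<le> enn2real (T u) - enn2real (T_pos u)"
    using fin T_pos_le by (intro always_eventually) (auto intro!: enn2real_mono)
  have "enn2real (T u) - enn2real (T_pos u) \<le> ?r u" for u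
  proof -
    let ?N = "\<integral>\<^sup>+s. ennreal (e (u - s)) * indicator {..<0} s \<partial>\<nu>"
    have "?N \<le> (\<Sum>i. if \<exists>s\<in>{..<0}. u - s < \<tau> i then ennreal (B * (c i * exp (\<beta> * \<tau> i))) else 0)"
      by (rule nn_integral_e_le) simp
    also have "\<dots> \<le> (\<Sum>i. ennreal (B * (if u < \<tau> i then c i * exp (\<beta> * \<tau> i) else 0)))"
      by (rule suminf_le) auto
    also have "\<dots> = ennreal (\<Sum>i. B * (if u < \<tau> i then c i * exp (\<beta> * \<tau> i) else 0))"
      using summable_mult[OF summable_tail] B_nonneg c_nonneg by (intro suminf_ennreal2) auto
    also have "(\<Sum>i. B * (if u < \<tau> i then c i * exp (\<beta> * \<tau> i) else 0)) = ?r u"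
      by (rule suminf_mult[OF summable_tail])
    finally have N: "?N \<le> ennreal (?r u)" .
    have r_nonneg: "0 \<le> ?r u"
      using B_nonneg c_nonneg summable_tail[of u] by (intro mult_nonneg_nonneg suminf_nonneg) auto
    have "enn2real (T u) = enn2real (T_pos u) + enn2real ?N"
      using fin'[of u] N by (simp add: T_split enn2real_plus le_less_trans)
    moreover have "enn2real ?N \<le> ?r u" using N r_nonneg by (rule enn2real_leI[rotated])
    ultimately show ?thesis by simp
  qed
  then show "\<forall>\<^sub>F u in at_top. enn2real (T u) - enn2real (T_pos u) \<le> ?r u" by simp
qed

section \<open>Boundedness of the solution and vanishing of its increments\<close>

lemma Z_ge: "ennreal (\<kappa> * a j * exp (- \<gamma> * a j) * v u) \<le> Z j u"
proof -
  have "ennreal (\<kappa> * a j * exp (- \<gamma> * a j) * v u)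
      = ennreal (exp (- \<gamma> * a j) * v u) * emeasure \<nu> {0..<a j}"
    using kappa_pos a_pos[of j] v_nonneg[of u] unfolding nu_period
    by (simp add: ennreal_mult[symmetric] mult_ac)
  also have "\<dots> = (\<integral>\<^sup>+s. ennreal (exp (- \<gamma> * a j) * v u) * indicator {0..<a j} s \<partial>\<nu>)"
    by (rule nn_integral_cmult_indicator[symmetric]) measurable
  also have "\<dots> \<le> Z j u"
    unfolding Z_def
  proof (rule nn_integral_mono)
    fix s
    show "ennreal (exp (- \<gamma> * a j) * v u) * indicator {0..<a j} s
        \<le> ennreal (v (u - s)) * indicator {0..<a j} s"
    proof (cases "s \<in> {0..<a j}")
      case True
      then have "exp (- \<gamma> * a j) * v u \<le> exp (- \<gamma> * s) * v u"
        using gamma_nonneg v_nonneg[of u] by (intro mult_right_mono) (auto intro!: mult_left_mono)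
      also have "\<dots> \<le> v (u - s)" using True by (intro v_shift) simp
      finally show ?thesis using True by (simp add: ennreal_leI)
    qed simp
  qed
  finally show ?thesis .
qed

text \<open>Keeps only the term \<open>j = 0\<close> of \<open>sum_Z\<close>; on its window
  \<open>v_shift\<close> keeps \<open>v\<close> above a fixed multiple of
  \<open>v u\<close>.\<close>

lemma T_pos_ge: "ennreal (m 0 * (\<kappa> * a 0 * exp (- \<gamma> * a 0) * v u)) \<le> T_pos u"
proof -
  have "ennreal (m 0 * (\<kappa> * a 0 * exp (- \<gamma> * a 0) * v u)) \<le> ennreal (m 0) * Z 0 u"
    using less_imp_le[OF m_pos[of 0]] kappa_pos a_pos[of 0] v_nonneg[of u] Z_ge[of 0 u]
    by (subst ennreal_mult) (auto intro!: mult_left_mono)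
  also have "\<dots> = (\<Sum>j\<in>{0}. ennreal (m j) * Z j u)" by simp
  also have "\<dots> \<le> (\<Sum>j. ennreal (m j) * Z j u)" by (rule sum_le_suminf) auto
  finally show ?thesis by (simp add: sum_Z)
qed

text \<open>The hypothesis \<open>v_le\<close> alone allows exponential growth. A uniform bound
  results from comparing the lower bound for \<open>T_pos\<close> with the bound
  \<open>B_total\<close>, which is free of \<open>u\<close>.\<close>

lemma v_bounded: obtains M where "\<And>u. v u \<le> M"
proof
  fix u
  let ?k = "m 0 * (\<kappa> * a 0 * exp (- \<gamma> * a 0))"
  have "ennreal (?k * v u) \<le> ennreal B_total"
    using T_pos_ge[of u] T_pos_le[of u] T_le[of u] by (simp add: mult.assoc)
  moreover have "0 \<le> B_total"
    unfolding B_total_def using c_summable B_nonneg c_nonneg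
    by (intro suminf_nonneg summable_mult) auto
  ultimately have "?k * v u \<le> B_total" by simp
  moreover have "0 < ?k" using m_pos[of 0] kappa_pos a_pos[of 0] by simp
  ultimately show "v u \<le> B_total / ?k" by (simp add: field_simps)
qed

text \<open>The shifts with vanishing increments form a group: for \<open>s - t\<close>, subtract
  the increments over \<open>s\<close> and \<open>t\<close> taken at \<open>u + t\<close>.\<close>

lemma increment_tendsto:
  assumes "g \<in> group_closure (range a)"
  shows "((\<lambda>u. v u - v (u - g)) \<longlongrightarrow> 0) at_top"
  using assms
proof (induction rule: group_closure.induct)
  case (base s)
  obtain M where "\<And>u. v u \<le> M" using v_bounded by blast
  then have "\<bar>v u\<bar> \<le> M" for u using v_nonneg[of u] by simp
  then have "((\<lambda>u. v u - v (u - a j)) \<longlongrightarrow> 0) at_top" for j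
    by (rule renewal_increment_tendsto[OF m_pos m_sums _ v_eq e_tendsto])
  with base show ?case by auto
next
  case (diff s t)
  have *: "filterlim (\<lambda>u. u + t) at_top at_top" using filterlim_minus_const_at_top[of "- t"] by simp
  have "((\<lambda>u. (v (u + t) - v (u + t - s)) - (v (u + t) - v (u + t - t))) \<longlongrightarrow> 0 - 0) at_top"
    by (intro tendsto_diff filterlim_compose[OF diff.IH(1) *] filterlim_compose[OF diff.IH(2) *])
  then show ?case by (simp add: algebra_simps)
qed

text \<open>The shift \<open>s\<close> lies between neighbouring multiples of a small element of the
  group. Across such a short gap \<open>v_shift\<close> lets \<open>v\<close> drop by at most
  \<open>\<epsilon> / 2\<close>, which gives one inequality from each neighbour.\<close>

lemma increment_tendsto_dense:
  assumes dense: "\<And>\<eta>. 0 < \<eta> \<Longrightarrow> \<exists>g\<in>group_closure (range a). 0 < g \<and> g < \<eta>"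
  shows "((\<lambda>u. v u - v (u - s)) \<longlongrightarrow> 0) at_top"
proof (rule tendstoI)
  fix \<epsilon> :: real assume "0 < \<epsilon>"
  obtain M where M: "\<And>u. v u \<le> M" using v_bounded by blast
  have "0 \<le> M" using M[of 0] v_nonneg[of 0] by linarith
  \<comment> \<open>Chosen so that \<open>\<gamma> * \<eta> * M < \<epsilon> / 2\<close>; the
    summand \<open>1\<close> keeps the denominator positive when
    \<open>\<gamma> * M = 0\<close>.\<close>
  define \<eta> where "\<eta> = \<epsilon> / (2 * (\<gamma> * M + 1))"
  have pos: "0 < \<gamma> * M + 1" using gamma_nonneg \<open>0 \<le> M\<close> by (simp add: add_nonneg_pos)
  then have "0 < \<eta>" using \<open>0 < \<epsilon>\<close> by (simp add: \<eta>_def)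
  have "\<epsilon> / (2 * k) * k = \<epsilon> / 2" if "0 < k" for k using that by simp
  from this[OF pos] have "\<eta> * (\<gamma> * M + 1) = \<epsilon> / 2" by (simp only: \<eta>_def)
  with \<open>0 < \<eta>\<close> have \<eta>: "\<gamma> * \<eta> * M < \<epsilon> / 2" by (simp add: algebra_simps)
  obtain g\<^sub>0 where g0: "g\<^sub>0 \<in> group_closure (range a)" "0 < g\<^sub>0" "g\<^sub>0 < \<eta>"
    using dense[OF \<open>0 < \<eta>\<close>] by blast
  define n where "n = \<lfloor>s / g\<^sub>0\<rfloor>"
  have mult: "g\<^sub>0 * of_int k \<in> group_closure (range a)" for k
    using group_closure_scalar_mult_right[OF g0(1)] by (cases k rule: int_cases2) auto
  have n: "g\<^sub>0 * of_int n \<le> s" "s < g\<^sub>0 * of_int (n + 1)"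
    using g0(2) floor_divide_lower[of g\<^sub>0 s] floor_divide_upper[of g\<^sub>0 s] by (auto simp: n_def algebra_simps)
  have loss: "x - \<epsilon> / 2 \<le> exp (- \<gamma> * r) * x" if "0 \<le> r" "r \<le> \<eta>" "0 \<le> x" "x \<le> M" for r x
  proof -
    have "1 - exp (- \<gamma> * r) \<le> \<gamma> * r" using exp_ge_add_one_self[of "- \<gamma> * r"] by simp
    also have "\<dots> \<le> \<gamma> * \<eta>" using that gamma_nonneg by (intro mult_left_mono)
    finally have "(1 - exp (- \<gamma> * r)) * x \<le> \<gamma> * \<eta> * x" using that by (intro mult_right_mono)
    also have "\<dots> \<le> \<gamma> * \<eta> * M" using that gamma_nonneg \<open>0 < \<eta>\<close> by (intro mult_left_mono) auto
    finally show ?thesis using \<eta> by (simp add: algebra_simps)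
  qed
  let ?g = "g\<^sub>0 * of_int n" and ?g' = "g\<^sub>0 * of_int (n + 1)"
  have "\<forall>\<^sub>F u in at_top. dist (v u - v (u - ?g)) 0 < \<epsilon> / 2"
    using \<open>0 < \<epsilon>\<close> by (intro tendstoD[OF increment_tendsto[OF mult]]) simp
  moreover have "\<forall>\<^sub>F u in at_top. dist (v u - v (u - ?g')) 0 < \<epsilon> / 2"
    using \<open>0 < \<epsilon>\<close> by (intro tendstoD[OF increment_tendsto[OF mult]]) simp
  ultimately show "\<forall>\<^sub>F u in at_top. dist (v u - v (u - s)) 0 < \<epsilon>"
  proof eventually_elim
    case (elim u)
    have "v (u - ?g) - \<epsilon> / 2 \<le> exp (- \<gamma> * (s - ?g)) * v (u - ?g)"
      using n g0 by (intro loss M v_nonneg) (auto simp: algebra_simps)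
    also have "\<dots> \<le> v (u - ?g - (s - ?g))" using n by (intro v_shift) simp
    finally have 1: "v (u - ?g) - \<epsilon> / 2 \<le> v (u - s)" by simp
    have "v (u - s) - \<epsilon> / 2 \<le> exp (- \<gamma> * (?g' - s)) * v (u - s)"
      using n g0 by (intro loss M v_nonneg) (auto simp: algebra_simps)
    also have "\<dots> \<le> v (u - s - (?g' - s))" using n by (intro v_shift) simp
    finally have 2: "v (u - s) - \<epsilon> / 2 \<le> v (u - ?g')" by simp
    from elim 1 2 show ?case unfolding dist_real_def by linarith
  qed
qed

section \<open>The limit profile\<close>

definition mean_value :: real where "mean_value = \<kappa> * (\<Sum>j. m j * a j)"

text \<open>By \<open>nu_period\<close>, \<open>mean_value\<close> is the average with weights
  \<open>m j\<close> of the \<open>\<nu>\<close>-masses of the windows \<open>{0..<a j}\<close>,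
  hence the factor of \<open>v u\<close> in the asymptotics of the left-hand side of
  \<open>sum_Z\<close>.\<close>

definition limit_profile :: "real \<Rightarrow> real" where "limit_profile u = enn2real (T u) / mean_value"

lemma mean_value_pos: "0 < mean_value"
  unfolding mean_value_def
  using kappa_pos mean m_pos a_pos by (intro mult_pos_pos suminf_pos) auto

lemma limit_profile_pos: "0 < limit_profile u"
proof -
  have "ennreal 0 < ennreal (m 0 * (\<kappa> * a 0 * exp (- \<gamma> * a 0) * v u))"
    using m_pos[of 0] kappa_pos a_pos[of 0] v_pos[of u] by (intro ennreal_lessI) simp_all
  also have "\<dots> \<le> T u" using T_pos_ge T_pos_le by (rule order_trans)
  finally have "0 < T u" by simp
  moreover have "T u < \<infinity>" using T_le[of u] by (simp add: le_less_trans)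
  ultimately show ?thesis
    unfolding limit_profile_def using mean_value_pos by (intro divide_pos_pos) (auto simp: enn2real_positive_iff)
qed

lemma limit_profile_shift:
  assumes "distr \<nu> borel (\<lambda>s. s + x) = \<nu>"
  shows "limit_profile (u + x) = limit_profile u"
proof -
  have "T (u + x) = (\<integral>\<^sup>+s. ennreal (e (u + x - (s + x))) \<partial>\<nu>)"
    unfolding T_def by (rule nn_integral_shift[OF _ assms, symmetric]) measurable
  then show ?thesis by (simp add: limit_profile_def T_def)
qed

text \<open>The difference \<open>v u * mean_value - T_pos u\<close> is the sum over
  \<open>j\<close> of \<open>m j\<close> times the integral of \<open>v u - v (u - s)\<close> over
  \<open>{0..<a j}\<close>. Dominated convergence applies first in \<open>s\<close>, then in
  \<open>j\<close> by the finite mean. The almost-everywhere form suits the lattice case, where only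
  shifts in the lattice are controlled.\<close>

lemma limit_profile_tendsto:
  assumes AE_increment: "AE s in \<nu>. ((\<lambda>u. v u - v (u - s)) \<longlongrightarrow> 0) at_top"
  shows "((\<lambda>u. v u - limit_profile u) \<longlongrightarrow> 0) at_top"
proof -
  obtain M where M: "\<And>u. v u \<le> M" using v_bounded by blast
  have "0 \<le> M" using M[of 0] v_nonneg[of 0] by linarith
  have fin: "emeasure \<nu> {0..<a j} < \<infinity>" for j by (simp add: nu_period)
  have meas: "measure \<nu> {0..<a j} = \<kappa> * a j" for j
    using kappa_pos a_pos[of j] by (simp add: measure_def nu_period)
  have int_ind: "integrable \<nu> (\<lambda>s. x * indicator {0..<a j} s :: real)" for x j
    using fin[of j] by (intro integrable_mult_right integrable_real_indicator) auto
  have int_v: "integrable \<nu> (\<lambda>s. v (u - s) * indicator {0..<a j} s)" for u j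
    by (rule Bochner_Integration.integrable_bound[OF int_ind[of M]])
       (use M v_nonneg \<open>0 \<le> M\<close> in \<open>auto simp: indicator_def\<close>)
  define z where "z j u = (\<integral>s. v (u - s) * indicator {0..<a j} s \<partial>\<nu>)" for j u
  have z_nonneg: "0 \<le> z j u" for j u
    unfolding z_def using v_nonneg by (intro integral_nonneg_AE) auto
  have Z_z: "Z j u = ennreal (z j u)" for j u
    unfolding Z_def z_def
    by (subst nn_integral_eq_integral[OF int_v, symmetric])
       (use v_nonneg in \<open>auto intro!: nn_integral_cong simp: indicator_def\<close>)
  have diff_eq: "v u * (\<kappa> * a j) - z j u = (\<integral>s. (v u - v (u - s)) * indicator {0..<a j} s \<partial>\<nu>)" for j u
  proof -
    have "(\<integral>s. (v u - v (u - s)) * indicator {0..<a j} s \<partial>\<nu>)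
        = (\<integral>s. v u * indicator {0..<a j} s - v (u - s) * indicator {0..<a j} s \<partial>\<nu>)"
      by (simp add: algebra_simps)
    also have "\<dots> = (\<integral>s. v u * indicator {0..<a j} s \<partial>\<nu>) - z j u"
      unfolding z_def by (rule Bochner_Integration.integral_diff[OF int_ind int_v])
    also have "(\<integral>s. v u * indicator {0..<a j} s \<partial>\<nu>) = v u * (\<kappa> * a j)"
      by (simp add: meas)
    finally show ?thesis by simp
  qed
  have abs_le: "\<bar>v u - v (u - s)\<bar> \<le> M" for u s
    using M[of u] M[of "u - s"] v_nonneg[of u] v_nonneg[of "u - s"] by linarith
  have diff_le: "norm (m j * (v u * (\<kappa> * a j) - z j u)) \<le> M * \<kappa> * (m j * a j)" for j u
  proof -
    have bound: "norm ((v u - v (u - s)) * indicator {0..<a j} s) \<le> M * indicator {0..<a j} s" for s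
      using abs_le by (auto simp: indicator_def)
    have "integrable \<nu> (\<lambda>s. (v u - v (u - s)) * indicator {0..<a j} s)"
      by (rule Bochner_Integration.integrable_bound[OF int_ind[of M j]])
         (use bound \<open>0 \<le> M\<close> in \<open>auto simp: abs_mult\<close>)
    then have "norm (\<integral>s. (v u - v (u - s)) * indicator {0..<a j} s \<partial>\<nu>) \<le> (\<integral>s. M * indicator {0..<a j} s \<partial>\<nu>)"
      by (intro Bochner_Integration.integral_norm_bound_integral int_ind bound)
    then have "\<bar>v u * (\<kappa> * a j) - z j u\<bar> \<le> M * (\<kappa> * a j)" by (simp add: diff_eq meas)
    then have "m j * \<bar>v u * (\<kappa> * a j) - z j u\<bar> \<le> m j * (M * (\<kappa> * a j))"
      using m_pos[of j] by (intro mult_left_mono) auto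
    then show ?thesis using m_pos[of j] by (simp add: abs_mult mult_ac)
  qed
  have diff_lim: "((\<lambda>u. v u * (\<kappa> * a j) - z j u) \<longlongrightarrow> 0) at_top" for j
  proof -
    have "((\<lambda>u. \<integral>s. (v u - v (u - s)) * indicator {0..<a j} s \<partial>\<nu>) \<longlongrightarrow> (\<integral>s. 0 \<partial>\<nu>)) at_top"
    proof (rule integral_dominated_convergence_at_top)
      show "integrable \<nu> (\<lambda>s. M * indicator {0..<a j} s :: real)" by (rule int_ind)
      show "AE s in \<nu>. ((\<lambda>u. (v u - v (u - s)) * indicator {0..<a j} s) \<longlongrightarrow> 0) at_top"
        using AE_increment by eventually_elim (auto intro: tendsto_mult_left_zero)
      show "\<forall>\<^sub>F u in at_top. AE s in \<nu>. norm ((v u - v (u - s)) * indicator {0..<a j} s) \<le> M * indicator {0..<a j} s"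
        using abs_le by (intro always_eventually allI AE_I2) (auto simp: indicator_def)
    qed measurable
    then show ?thesis by (simp add: diff_eq)
  qed
  have summ: "summable (\<lambda>j. M * \<kappa> * (m j * a j))" using mean by (rule summable_mult)
  have lim0: "((\<lambda>u. \<Sum>j. m j * (v u * (\<kappa> * a j) - z j u)) \<longlongrightarrow> (\<Sum>j::nat. 0)) at_top"
  proof (rule tannerys_theorem[THEN conjunct2, THEN conjunct2, OF _ _ summ])
    show "((\<lambda>u. m j * (v u * (\<kappa> * a j) - z j u)) \<longlongrightarrow> 0) at_top" for j
      using tendsto_mult_left[OF diff_lim[of j], of "m j"] by simp
    show "\<forall>\<^sub>F (j, u) in sequentially \<times>\<^sub>F at_top. norm (m j * (v u * (\<kappa> * a j) - z j u)) \<le> M * \<kappa> * (m j * a j)"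
      using diff_le by (intro always_eventually) auto
  qed simp
  have sum_eq: "(\<Sum>j. m j * (v u * (\<kappa> * a j) - z j u)) = v u * mean_value - enn2real (T_pos u)" for u
  proof -
    have s1: "summable (\<lambda>j. m j * (v u * (\<kappa> * a j) - z j u))"
      by (rule summable_comparison_test'[OF summ, of 0]) (rule diff_le)
    have s2: "(\<lambda>j. v u * \<kappa> * (m j * a j)) sums (v u * mean_value)"
      using sums_mult[OF summable_sums[OF mean], of "v u * \<kappa>"] by (simp add: mean_value_def mult.assoc)
    have s3: "summable (\<lambda>j. m j * z j u)"
      using summable_diff[OF sums_summable[OF s2] s1] by (simp add: algebra_simps)
    have "T_pos u = (\<Sum>j. ennreal (m j * z j u))"
      using less_imp_le[OF m_pos] z_nonneg by (simp add: sum_Z[symmetric] Z_z ennreal_mult)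
    also have "\<dots> = ennreal (\<Sum>j. m j * z j u)"
      using less_imp_le[OF m_pos] z_nonneg s3 by (intro suminf_ennreal2) auto
    finally have "enn2real (T_pos u) = (\<Sum>j. m j * z j u)"
      using less_imp_le[OF m_pos] z_nonneg s3 by (simp add: suminf_nonneg)
    then have "(\<lambda>j. v u * \<kappa> * (m j * a j) - m j * z j u) sums (v u * mean_value - enn2real (T_pos u))"
      using sums_diff[OF s2 summable_sums[OF s3]] by simp
    then show ?thesis by (simp add: sums_iff algebra_simps)
  qed
  have "((\<lambda>u. ((v u * mean_value - enn2real (T_pos u)) - (enn2real (T u) - enn2real (T_pos u))) / mean_value)
      \<longlongrightarrow> (0 - 0) / mean_value) at_top"
    using lim0 mean_value_pos unfolding sum_eq
    by (intro tendsto_divide tendsto_diff tendsto_const T_minus_T_pos_tendsto) auto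
  then show ?thesis
    using mean_value_pos by (simp add: limit_profile_def diff_divide_distrib)
qed

end

section \<open>Lebesgue measure and lattice measures\<close>

lemma nn_integral_exp_tail_lborel:
  assumes "0 < \<beta>"
  shows "(\<integral>\<^sup>+s. ennreal (exp (- \<beta> * s)) * indicator {x..} s \<partial>lborel) = ennreal (1 / \<beta> * exp (- \<beta> * x))"
proof -
  have "((\<lambda>s. exp (- \<beta> * s)) \<longlongrightarrow> 0) at_top"
    using assms
    by (intro filterlim_compose[OF exp_at_bot] filterlim_tendsto_neg_mult_at_bot[OF tendsto_const] filterlim_ident) auto
  then have "((\<lambda>s. - (1 / \<beta>) * exp (- \<beta> * s)) \<longlongrightarrow> - (1 / \<beta>) * 0) at_top"
    by (intro tendsto_mult tendsto_const)
  then have "((\<lambda>s. - (1 / \<beta>) * exp (- \<beta> * s)) \<longlongrightarrow> 0) at_top" by simp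
  then have "(\<integral>\<^sup>+s. ennreal (exp (- \<beta> * s)) * indicator {x..} s \<partial>lborel) = ennreal (0 - (- (1 / \<beta>) * exp (- \<beta> * x)))"
    using assms by (intro nn_integral_FTC_atLeast) (auto intro!: derivative_eq_intros)
  then show ?thesis by simp
qed

lemma lborel_shift: "distr lborel borel (\<lambda>s. s + x) = (lborel :: real measure)"
proof -
  have "(\<lambda>s. s + x) = (+) x" by (rule ext) simp
  then show ?thesis by (simp add: lborel_distr_plus)
qed

text \<open>Counting measure is pushed forward to the reals, so that the measurable sets are the
  Borel sets and one locale covers this measure and Lebesgue measure alike.\<close>

definition lattice_measure :: "real \<Rightarrow> real measure" where
  "lattice_measure h = distr (count_space UNIV) borel (\<lambda>n::int. h * of_int n)"

lemma sets_lattice_measure [simp]: "sets (lattice_measure h) = sets borel"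
  by (simp add: lattice_measure_def)

lemma lattice_measure_shift:
  "distr (lattice_measure h) borel (\<lambda>s. s + h * of_int k) = lattice_measure h"
proof -
  have "distr (lattice_measure h) borel (\<lambda>s. s + h * of_int k)
      = distr (count_space UNIV) borel ((\<lambda>n::int. h * of_int n) \<circ> (\<lambda>n. n + k))"
    unfolding lattice_measure_def by (subst distr_distr) (auto simp: comp_def algebra_simps)
  also have "\<dots> = distr (distr (count_space UNIV) (count_space UNIV) (\<lambda>n. n + k)) borel (\<lambda>n::int. h * of_int n)"
    by (rule distr_distr[symmetric]) auto
  also have "distr (count_space UNIV) (count_space UNIV) (\<lambda>n::int. n + k) = count_space UNIV"
    by (intro distr_bij_count_space bij_plus_right)
  finally show ?thesis by (simp add: lattice_measure_def)
qed

text \<open>A half-open window contains exactly \<open>k\<close> lattice points, so mass is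
  proportional to length without boundary correction; this gives
  \<open>\<kappa> = 1 / h\<close>.\<close>

lemma emeasure_lattice_measure_Ico:
  assumes "0 < h" "0 \<le> k"
  shows "emeasure (lattice_measure h) {0..<h * of_int k} = ennreal (of_int k)"
proof -
  have "(\<lambda>n::int. h * of_int n) -` {0..<h * of_int k} = {0..<k}"
    using assms by (auto simp: zero_le_mult_iff)
  then have "emeasure (lattice_measure h) {0..<h * of_int k} = emeasure (count_space UNIV) {0..<k}"
    unfolding lattice_measure_def by (subst emeasure_distr) auto
  also have "\<dots> = ennreal (of_int k)"
    using assms by (simp add: emeasure_count_space_finite ennreal_of_nat_eq_real_of_nat)
  finally show ?thesis .
qed

text \<open>A geometric series starting at the first lattice point \<open>h * of_int k\<close> not
  below \<open>x\<close>; the inequality comes from rounding \<open>x\<close> up to that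
  point.\<close>

lemma nn_integral_exp_tail_lattice:
  assumes "0 < \<beta>" "0 < h"
  shows "(\<integral>\<^sup>+s. ennreal (exp (- \<beta> * s)) * indicator {x..} s \<partial>lattice_measure h)
    \<le> ennreal (1 / (1 - exp (- \<beta> * h)) * exp (- \<beta> * x))"
proof -
  define k where "k = \<lceil>x / h\<rceil>"
  define r where "r = exp (- \<beta> * h)"
  have r: "0 < r" "r < 1" using assms by (auto simp: r_def)
  have k: "x \<le> h * of_int n \<longleftrightarrow> k \<le> n" for n
    using assms by (simp add: k_def ceiling_le_iff divide_le_eq mult.commute)
  have "(\<integral>\<^sup>+s. ennreal (exp (- \<beta> * s)) * indicator {x..} s \<partial>lattice_measure h)
      = (\<integral>\<^sup>+n. ennreal (exp (- \<beta> * (h * of_int n))) * indicator {x..} (h * of_int n) \<partial>count_space UNIV)"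
    unfolding lattice_measure_def by (rule nn_integral_distr) auto
  also have "\<dots> = (\<integral>\<^sup>+n. ennreal (exp (- \<beta> * (h * of_int n))) * indicator {k..} n \<partial>count_space UNIV)"
    using k by (intro nn_integral_cong) (auto simp: indicator_def)
  also have "\<dots> = (\<integral>\<^sup>+n. ennreal (exp (- \<beta> * (h * of_int n))) \<partial>count_space {k..})"
    by (rule nn_integral_count_space_indicator[symmetric]) simp
  also have "\<dots> = (\<integral>\<^sup>+i. ennreal (exp (- \<beta> * (h * of_int (k + int i)))) \<partial>count_space UNIV)"
  proof (rule nn_integral_bij_count_space[symmetric])
    show "bij_betw (\<lambda>i. k + int i) UNIV {k..}"
      by (rule bij_betwI[where g = "\<lambda>n. nat (n - k)"]) auto
  qed
  also have "\<dots> = (\<Sum>i. ennreal (exp (- \<beta> * (h * of_int (k + int i)))))"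
    by (rule nn_integral_count_space_nat)
  also have "\<dots> = (\<Sum>i. ennreal (exp (- \<beta> * (h * of_int k)) * r ^ i))"
    by (intro suminf_cong arg_cong[where f = ennreal])
       (simp add: r_def exp_of_nat_mult[symmetric] exp_add[symmetric] algebra_simps)
  also have "\<dots> = ennreal (exp (- \<beta> * (h * of_int k)) * (1 / (1 - r)))"
    using r by (intro suminf_ennreal_eq sums_mult geometric_sums) auto
  also have "\<dots> \<le> ennreal (1 / (1 - r) * exp (- \<beta> * x))"
  proof (rule ennreal_leI)
    have "exp (- \<beta> * (h * of_int k)) \<le> exp (- \<beta> * x)" using k[of k] assms by simp
    then have "1 / (1 - r) * exp (- \<beta> * (h * of_int k)) \<le> 1 / (1 - r) * exp (- \<beta> * x)"
      using r by (intro mult_left_mono) auto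
    then show "exp (- \<beta> * (h * of_int k)) * (1 / (1 - r)) \<le> 1 / (1 - r) * exp (- \<beta> * x)"
      by (simp only: mult.commute)
  qed
  finally show ?thesis by (simp add: r_def)
qed

context renewal_equation
begin

text \<open>The group generated by the steps decides which measure \<open>\<nu>\<close> is inserted.
  For a cyclic group it is the lattice measure, which is invariant under \<open>h\<close>; for a
  dense one it is Lebesgue measure, whose invariance under all translations makes the profile
  constant.\<close>

theorem renewal_theorem:
  "\<exists>P. (\<forall>u. 0 < P u) \<and> ((\<lambda>u. v u - P u) \<longlongrightarrow> 0) at_top \<and>
    (\<not> arithmetic (range a) \<longrightarrow> (\<exists>c'. \<forall>u. P u = c')) \<and>
    (arithmetic (range a) \<longrightarrow>
      (\<exists>h>0. group_closure (range a) = range (\<lambda>n::int. h * of_int n) \<and> (\<forall>u. P (u + h) = P u)))"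
proof -
  have a_mem: "a j \<in> group_closure (range a)" for j by (rule group_closure.base) simp
  have "\<exists>x\<in>group_closure (range a). 0 < x" using a_mem[of 0] a_pos[of 0] by blast
  then consider (cyclic) h where "0 < h" "group_closure (range a) = range (\<lambda>n::int. h * of_int n)"
    | (dense) "\<And>\<eta>. 0 < \<eta> \<Longrightarrow> \<exists>g\<in>group_closure (range a). 0 < g \<and> g < \<eta>"
    using real_subgroup_cases[OF zero_in_group_closure group_closure.diff] by blast
  then show ?thesis
  proof cases
    case (cyclic h)
    have "\<exists>n::int. a j = h * of_int n" for j using a_mem[of j] cyclic by auto
    then obtain k :: "nat \<Rightarrow> int" where k: "\<And>j. a j = h * of_int (k j)" by metis
    have k_nonneg: "0 \<le> k j" for j using a_pos[of j] cyclic(1) by (simp add: k zero_less_mult_iff)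
    interpret renewal_equation_measure m a v e c \<tau> \<beta> \<gamma> C "lattice_measure h" "1 / h" "1 / (1 - exp (- \<beta> * h))"
    proof unfold_locales
      show "distr (lattice_measure h) borel (\<lambda>s. s + a j) = lattice_measure h" for j
        unfolding k by (rule lattice_measure_shift)
      show "emeasure (lattice_measure h) {0..<a j} = ennreal (1 / h * a j)" for j
        using emeasure_lattice_measure_Ico[OF cyclic(1) k_nonneg] cyclic(1) by (simp add: k)
      show "(\<integral>\<^sup>+s. ennreal (exp (- \<beta> * s)) * indicator {x..} s \<partial>lattice_measure h)
          \<le> ennreal (1 / (1 - exp (- \<beta> * h)) * exp (- \<beta> * x))" for x
        by (rule nn_integral_exp_tail_lattice[OF beta_pos cyclic(1)])
    qed (use cyclic beta_pos in auto)
    have "arithmetic (range a)" using cyclic(1) k unfolding arithmetic_def by auto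
    moreover have "AE s in lattice_measure h. ((\<lambda>u. v u - v (u - s)) \<longlongrightarrow> 0) at_top"
    proof -
      \<comment> \<open>The lattice measure is concentrated on the lattice, and these are exactly
        the shifts covered by \<open>increment_tendsto\<close>.\<close>
      have "AE s in lattice_measure h. s \<in> range (\<lambda>n::int. h * of_int n)"
      proof -
        have "range (\<lambda>n::int. h * of_int n) \<in> sets borel"
          by (rule sets.countable) auto
        then have "{s \<in> space borel. s \<in> range (\<lambda>n::int. h * of_int n)} \<in> sets borel" by simp
        then show ?thesis unfolding lattice_measure_def by (subst AE_distr_iff) auto
      qed
      then show ?thesis
        by eventually_elim (use cyclic(2) increment_tendsto in blast)
    qed
    moreover have "limit_profile (u + h) = limit_profile u" for u
      using lattice_measure_shift[of h 1] by (intro limit_profile_shift) simp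
    ultimately show ?thesis
      using limit_profile_pos limit_profile_tendsto cyclic by (intro exI[of _ limit_profile]) blast
  next
    case dense
    interpret renewal_equation_measure m a v e c \<tau> \<beta> \<gamma> C lborel 1 "1 / \<beta>"
    proof unfold_locales
      show "distr lborel borel (\<lambda>s. s + a j) = lborel" for j
        by (rule lborel_shift)
      show "emeasure lborel {0..<a j} = ennreal (1 * a j)" for j
        using a_pos[of j] by simp
      show "(\<integral>\<^sup>+s. ennreal (exp (- \<beta> * s)) * indicator {x..} s \<partial>lborel) \<le> ennreal (1 / \<beta> * exp (- \<beta> * x))" for x
        using nn_integral_exp_tail_lborel[OF beta_pos, of x] by simp
    qed (use beta_pos in auto)
    \<comment> \<open>A lattice containing all steps would contain the group they generate, but it
      has no element strictly between \<open>0\<close> and its generator.\<close>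
    have "\<not> arithmetic (range a)"
    proof
      assume "arithmetic (range a)"
      then obtain h where h: "0 < h" "range a \<subseteq> range (\<lambda>n::int. h * of_int n)" by (auto simp: arithmetic_def)
      have "g \<in> range (\<lambda>n::int. h * of_int n)" if "g \<in> group_closure (range a)" for g
        using that
      proof (induction rule: group_closure.induct)
        case (base s)
        have "0 = h * of_int 0" by simp
        with base h show ?case by blast
      next
        case (diff s t)
        then obtain i k :: int where "s = h * of_int i" "t = h * of_int k" by blast
        then have "s - t = h * of_int (i - k)" by (simp add: algebra_simps)
        then show ?case by blast
      qed
      moreover obtain g where "g \<in> group_closure (range a)" "0 < g" "g < h" using dense[OF h(1)] by blast
      ultimately obtain n :: int where "0 < h * of_int n" "h * of_int n < h" by blast
      with h(1) have "0 < n" "n < 1" by (auto simp: zero_less_mult_iff)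
      then show False by simp
    qed
    moreover have "limit_profile u = limit_profile 0" for u
      using limit_profile_shift[OF lborel_shift, of 0 u] by simp
    ultimately show ?thesis
      using limit_profile_pos limit_profile_tendsto increment_tendsto_dense[OF dense]
      by (intro exI[of _ limit_profile]) blast
  qed
qed

end

section \<open>Similarities, Lebesgue measure and self-similar measures\<close>

lemma sums_of_suminf_ennreal:
  assumes nonneg: "\<And>n. 0 \<le> f n" and eq: "(\<Sum>n. ennreal (f n)) = x" and "x \<noteq> \<infinity>"
  shows "f sums enn2real x"
proof -
  have "summable f" using assms by (intro summable_suminf_not_top) auto
  moreover from this have "x = ennreal (\<Sum>n. f n)" using suminf_ennreal2[OF nonneg] eq by simp
  ultimately show ?thesis by (auto simp: sums_iff suminf_nonneg nonneg)
qed

lemma nn_integral_lborel_shift: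
  fixes w :: "'a::euclidean_space"
  assumes [measurable]: "f \<in> borel_measurable borel"
  shows "(\<integral>\<^sup>+x. f (w + x) \<partial>lborel) = (\<integral>\<^sup>+x. f x \<partial>lborel)"
proof -
  have "(\<integral>\<^sup>+x. f x \<partial>lborel) = (\<integral>\<^sup>+x. f x \<partial>distr lborel borel ((+) w))"
    by (simp only: lborel_distr_plus)
  also have "\<dots> = (\<integral>\<^sup>+x. f (w + x) \<partial>lborel)" by (rule nn_integral_distr) measurable
  finally show ?thesis by simp
qed

text \<open>The image of Lebesgue measure under a similarity is again translation invariant; comparing the
  two on a ball by Fubini's theorem determines the constant.\<close>

lemma nn_integral_similarity:
  fixes T :: "'a::euclidean_space \<Rightarrow> 'a"
  assumes "0 < c" and R: "orthogonal_transformation R" and T: "\<And>x. T x = c *\<^sub>R R x + b"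
    and [measurable]: "f \<in> borel_measurable borel"
  shows "ennreal (c ^ DIM('a)) * (\<integral>\<^sup>+x. f (T x) \<partial>lborel) = (\<integral>\<^sup>+x. f x \<partial>lborel)"
proof -
  let ?B = "ball (0::'a) 1"
  define \<Lambda> where "\<Lambda> = emeasure lborel ?B"
  have [measurable]: "ball x r \<in> sets borel" for x :: 'a and r by simp
  have \<Lambda>: "\<Lambda> = ennreal (unit_ball_vol (real DIM('a)))"
    by (simp add: \<Lambda>_def emeasure_ball)
  have R_lin: "linear R" using R by (rule orthogonal_transformation_linear)
  have dist_T: "dist (T x) (T y) = c * dist x y" for x y
  proof -
    have "T x - T y = c *\<^sub>R R (x - y)"
      using R_lin by (simp add: T linear_diff scaleR_diff_right)
    then show ?thesis
      using \<open>0 < c\<close> R by (simp add: dist_norm orthogonal_transformation_norm)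
  qed
  have T_surj: "\<exists>x. T x = z" for z
  proof -
    obtain x where "R x = (1 / c) *\<^sub>R (z - b)"
      using orthogonal_transformation_surj[OF R] by (metis surjD)
    then show ?thesis using \<open>0 < c\<close> by (intro exI[of _ x]) (simp add: T)
  qed
  have T_add: "\<exists>w. \<forall>x. T (w + x) = y + T x" for y
  proof -
    obtain w where "R w = (1 / c) *\<^sub>R y"
      using orthogonal_transformation_surj[OF R] by (metis surjD)
    then show ?thesis using \<open>0 < c\<close> R_lin
      by (intro exI[of _ w]) (simp add: T linear_add scaleR_add_right)
  qed
  have [measurable]: "T \<in> borel_measurable borel"
    unfolding T[abs_def] using R_lin
    by (intro borel_measurable_continuous_onI continuous_intros linear_continuous_on)
       (simp add: linear_conv_bounded_linear)
  have "\<Lambda> * (\<integral>\<^sup>+x. f (T x) \<partial>lborel) = (\<integral>\<^sup>+x. f (T x) \<partial>lborel) * (\<integral>\<^sup>+y. indicator ?B y \<partial>lborel)"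
    by (simp add: \<Lambda>_def mult.commute)
  also have "\<dots> = (\<integral>\<^sup>+y. (\<integral>\<^sup>+x. f (T x) \<partial>lborel) * indicator ?B y \<partial>lborel)"
    by (rule nn_integral_cmult[symmetric]) measurable
  also have "\<dots> = (\<integral>\<^sup>+y. \<integral>\<^sup>+x. f (T x + y) * indicator ?B y \<partial>lborel \<partial>lborel)"
  proof (rule nn_integral_cong)
    \<comment> \<open>Adding \<open>y\<close> after applying \<open>T\<close> amounts to a
      translation before applying \<open>T\<close>, under which Lebesgue measure is
      invariant.\<close>
    fix y
    obtain w where w: "\<And>x. T (w + x) = y + T x" using T_add by blast
    have "(\<integral>\<^sup>+x. f (T x + y) * indicator ?B y \<partial>lborel) = (\<integral>\<^sup>+x. f (T (w + x)) * indicator ?B y \<partial>lborel)"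
      unfolding w by (simp add: add.commute)
    also have "\<dots> = (\<integral>\<^sup>+x. f (T x) * indicator ?B y \<partial>lborel)"
      by (rule nn_integral_lborel_shift) measurable
    also have "\<dots> = (\<integral>\<^sup>+x. f (T x) \<partial>lborel) * indicator ?B y"
      by (rule nn_integral_multc) measurable
    finally show "(\<integral>\<^sup>+x. f (T x) \<partial>lborel) * indicator ?B y = (\<integral>\<^sup>+x. f (T x + y) * indicator ?B y \<partial>lborel)" ..
  qed
  also have "\<dots> = (\<integral>\<^sup>+x. \<integral>\<^sup>+y. f (T x + y) * indicator ?B y \<partial>lborel \<partial>lborel)"
    by (rule lborel_pair.Fubini') measurable
  also have "\<dots> = (\<integral>\<^sup>+x. \<integral>\<^sup>+z. f z * indicator (ball (T x) 1) z \<partial>lborel \<partial>lborel)"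
  proof (rule nn_integral_cong)
    fix x
    have "(\<integral>\<^sup>+y. f (T x + y) * indicator ?B y \<partial>lborel) = (\<integral>\<^sup>+y. f (T x + y) * indicator (ball (T x) 1) (T x + y) \<partial>lborel)"
      by (intro nn_integral_cong) (auto simp: indicator_def dist_norm)
    also have "\<dots> = (\<integral>\<^sup>+z. f z * indicator (ball (T x) 1) z \<partial>lborel)"
      by (rule nn_integral_lborel_shift) measurable
    finally show "(\<integral>\<^sup>+y. f (T x + y) * indicator ?B y \<partial>lborel) = (\<integral>\<^sup>+z. f z * indicator (ball (T x) 1) z \<partial>lborel)" .
  qed
  also have "\<dots> = (\<integral>\<^sup>+x. \<integral>\<^sup>+z. f z * indicator {w. dist (T (fst w)) (snd w) < 1} (x, z) \<partial>lborel \<partial>lborel)"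
    by (intro nn_integral_cong) (auto simp: indicator_def)
  also have "\<dots> = (\<integral>\<^sup>+z. \<integral>\<^sup>+x. f z * indicator {w. dist (T (fst w)) (snd w) < 1} (x, z) \<partial>lborel \<partial>lborel)"
    by (rule lborel_pair.Fubini'[symmetric]) measurable
  \<comment> \<open>The points that \<open>T\<close> sends into the unit ball around
    \<open>z\<close> form a ball of radius \<open>1 / c\<close> around the preimage of
    \<open>z\<close>; this is the source of the constant.\<close>
  also have "\<dots> = (\<integral>\<^sup>+z. f z * (ennreal (1 / c ^ DIM('a)) * \<Lambda>) \<partial>lborel)"
  proof (rule nn_integral_cong)
    fix z
    obtain x\<^sub>0 where x0: "T x\<^sub>0 = z" using T_surj by blast
    have "(\<integral>\<^sup>+x. f z * indicator {w. dist (T (fst w)) (snd w) < 1} (x, z) \<partial>lborel)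
        = (\<integral>\<^sup>+x. f z * indicator (ball x\<^sub>0 (1 / c)) x \<partial>lborel)"
      using dist_T[of _ x\<^sub>0] \<open>0 < c\<close>
      by (intro nn_integral_cong) (auto simp: indicator_def x0 field_simps dist_commute)
    also have "\<dots> = f z * emeasure lborel (ball x\<^sub>0 (1 / c))"
      by (rule nn_integral_cmult_indicator) simp
    also have "emeasure lborel (ball x\<^sub>0 (1 / c)) = ennreal (1 / c ^ DIM('a)) * \<Lambda>"
      using \<open>0 < c\<close> unfolding \<Lambda>
      by (simp add: emeasure_ball ennreal_mult[symmetric] power_one_over mult.commute)
    finally show "(\<integral>\<^sup>+x. f z * indicator {w. dist (T (fst w)) (snd w) < 1} (x, z) \<partial>lborel)
        = f z * (ennreal (1 / c ^ DIM('a)) * \<Lambda>)" .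
  qed
  also have "\<dots> = (\<integral>\<^sup>+z. f z \<partial>lborel) * (ennreal (1 / c ^ DIM('a)) * \<Lambda>)"
    by (rule nn_integral_multc) measurable
  finally have "\<Lambda> * (\<integral>\<^sup>+x. f (T x) \<partial>lborel) = \<Lambda> * (ennreal (1 / c ^ DIM('a)) * (\<integral>\<^sup>+z. f z \<partial>lborel))"
    by (simp add: mult_ac)
  moreover have "0 < \<Lambda>" "\<Lambda> \<noteq> \<infinity>" unfolding \<Lambda> by simp_all
  ultimately have "(\<integral>\<^sup>+x. f (T x) \<partial>lborel) = ennreal (1 / c ^ DIM('a)) * (\<integral>\<^sup>+z. f z \<partial>lborel)"
    by (auto simp: ennreal_mult_cancel_left)
  then have "ennreal (c ^ DIM('a)) * (\<integral>\<^sup>+x. f (T x) \<partial>lborel)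
      = (ennreal (c ^ DIM('a)) * ennreal (1 / c ^ DIM('a))) * (\<integral>\<^sup>+z. f z \<partial>lborel)"
    by (simp add: mult.assoc)
  also have "ennreal (c ^ DIM('a)) * ennreal (1 / c ^ DIM('a)) = 1"
    using \<open>0 < c\<close> by (simp add: ennreal_mult[symmetric])
  finally show ?thesis by simp
qed

lemma measurable_emeasure_vimage_ball:
  fixes g :: "'b::euclidean_space \<Rightarrow> 'a::euclidean_space"
  assumes "finite_measure M" and [measurable_cong]: "sets M = sets borel"
    and [measurable]: "g \<in> borel_measurable borel"
  shows "(\<lambda>x. emeasure M (g -` ball x t)) \<in> borel_measurable borel"
proof -
  interpret finite_measure M by fact
  have "{w \<in> space (borel \<Otimes>\<^sub>M M). dist (fst w) (g (snd w)) < t} \<in> sets (borel \<Otimes>\<^sub>M M)"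
    by measurable
  from measurable_emeasure_Pair[OF this]
  have "(\<lambda>x. emeasure M (Pair x -` {w \<in> space (borel \<Otimes>\<^sub>M M). dist (fst w) (g (snd w)) < t})) \<in> borel_measurable borel" .
  moreover have "Pair x -` {w \<in> space (borel \<Otimes>\<^sub>M M). dist (fst w) (g (snd w)) < t} = g -` ball x t" for x
    using sets_eq_imp_space_eq[OF assms(2)] by (auto simp: space_pair_measure)
  ultimately show ?thesis by simp
qed

text \<open>By Fubini's theorem the integral over \<open>x\<close> comes first: for fixed
  \<open>y\<close> the admissible \<open>x\<close> form a ball around \<open>g y\<close>, whose
  volume is independent of \<open>y\<close>, and \<open>M\<close> has mass \<open>1\<close>.\<close>

lemma nn_integral_emeasure_vimage_ball:
  fixes g :: "'b::euclidean_space \<Rightarrow> 'a::euclidean_space"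
  assumes "prob_space M" and sets [measurable_cong]: "sets M = sets borel"
    and [measurable]: "g \<in> borel_measurable borel" and "0 \<le> t"
  shows "(\<integral>\<^sup>+x. emeasure M (g -` ball x t) \<partial>lborel) = ennreal (unit_ball_vol (real DIM('a)) * t ^ DIM('a))"
proof -
  interpret prob_space M by fact
  interpret pair: pair_sigma_finite lborel M ..
  have "(\<integral>\<^sup>+x. emeasure M (g -` ball x t) \<partial>lborel)
      = (\<integral>\<^sup>+x. \<integral>\<^sup>+y. indicator {w. dist (fst w) (g (snd w)) < t} (x, y) \<partial>M \<partial>lborel)"
  proof (rule nn_integral_cong)
    fix x
    have "g -` ball x t \<in> sets M"
      using measurable_sets_borel[OF assms(3), of "ball x t"] by (simp add: sets)
    then have "emeasure M (g -` ball x t) = (\<integral>\<^sup>+y. indicator (g -` ball x t) y \<partial>M)"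
      by simp
    also have "\<dots> = (\<integral>\<^sup>+y. indicator {w. dist (fst w) (g (snd w)) < t} (x, y) \<partial>M)"
      by (intro nn_integral_cong) (auto simp: indicator_def)
    finally show "emeasure M (g -` ball x t) = (\<integral>\<^sup>+y. indicator {w. dist (fst w) (g (snd w)) < t} (x, y) \<partial>M)" .
  qed
  also have "\<dots> = (\<integral>\<^sup>+y. \<integral>\<^sup>+x. indicator {w. dist (fst w) (g (snd w)) < t} (x, y) \<partial>lborel \<partial>M)"
    by (rule pair.Fubini'[symmetric]) measurable
  also have "\<dots> = (\<integral>\<^sup>+y. ennreal (unit_ball_vol (real DIM('a)) * t ^ DIM('a)) \<partial>M)"
  proof (rule nn_integral_cong)
    fix y
    have "(\<integral>\<^sup>+x. indicator {w. dist (fst w) (g (snd w)) < t} (x, y) \<partial>lborel)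
        = (\<integral>\<^sup>+x. indicator (ball (g y) t) x \<partial>lborel)"
      by (intro nn_integral_cong) (auto simp: indicator_def dist_commute)
    also have "\<dots> = ennreal (unit_ball_vol (real DIM('a)) * t ^ DIM('a))"
      using \<open>0 \<le> t\<close> by (simp add: emeasure_ball)
    finally show "(\<integral>\<^sup>+x. indicator {w. dist (fst w) (g (snd w)) < t} (x, y) \<partial>lborel)
        = ennreal (unit_ball_vol (real DIM('a)) * t ^ DIM('a))" .
  qed
  also have "\<dots> = ennreal (unit_ball_vol (real DIM('a)) * t ^ DIM('a))"
    by (simp add: emeasure_space_1)
  finally show ?thesis .
qed

text \<open>The distance \<open>h\<close> to \<open>U\<close> satisfies \<open>h \<circ> S j \<le> \<rho> j * h\<close>, so self-similarity makes
  \<open>\<mu> {h > s}\<close> invariant under \<open>s \<mapsto> s / \<rho> 0\<close>; it tends to \<open>0\<close> as \<open>s \<rightarrow> \<infinity>\<close>.\<close>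

lemma self_similar_measure_AE_closure:
  fixes S :: "nat \<Rightarrow> 'a::euclidean_space \<Rightarrow> 'a"
  assumes rho: "\<And>j. 0 < \<rho> j" "\<And>j. \<rho> j < 1" and lip: "\<And>j x y. dist (S j x) (S j y) \<le> \<rho> j * dist x y"
    and inv: "\<And>j. S j ` U \<subseteq> U" and "U \<noteq> {}"
    and p_pos: "\<And>j. 0 < p j" and p_sums: "p sums 1"
    and ssm: "is_self_similar_measure S p M"
  shows "AE x in M. x \<in> closure U"
proof -
  interpret prob_space M using ssm by (simp add: is_self_similar_measure_def)
  have sets [measurable_cong]: "sets M = sets borel" using ssm by (simp add: is_self_similar_measure_def)
  have space: "space M = UNIV" using sets_eq_imp_space_eq[OF sets] by simp
  define h where "h x = infdist x U" for x
  have [measurable]: "h \<in> borel_measurable borel"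
    unfolding h_def by (intro borel_measurable_continuous_onI continuous_intros)
  have h_nonneg: "0 \<le> h x" for x by (simp add: h_def infdist_nonneg)
  have h_S: "h (S j x) \<le> \<rho> j * h x" for j x
  proof -
    have "h (S j x) / \<rho> j \<le> dist x u" if "u \<in> U" for u
    proof -
      have "h (S j x) \<le> dist (S j x) (S j u)" unfolding h_def using that inv by (intro infdist_le) blast
      also have "\<dots> \<le> \<rho> j * dist x u" by (rule lip)
      finally show ?thesis using rho(1)[of j] by (simp add: divide_le_eq mult.commute)
    qed
    then have "h (S j x) / \<rho> j \<le> h x"
      unfolding h_def infdist_notempty[OF \<open>U \<noteq> {}\<close>] by (intro cINF_greatest \<open>U \<noteq> {}\<close>) auto
    then show ?thesis using rho(1)[of j] by (simp add: divide_le_eq mult.commute)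
  qed
  define G where "G s = measure M {x. s < h x}" for s
  have G_sets: "{x. s < h x} \<in> sets M" for s unfolding sets by measurable
  have G_mono: "G s' \<le> G s" if "s \<le> s'" for s s'
    unfolding G_def using that by (intro finite_measure_mono G_sets) auto
  have G_eq: "G (s / \<rho> 0) = G s" if "0 < s" for s
  proof -
    have "s \<le> s / \<rho> j" for j using rho[of j] that by (simp add: le_divide_eq mult_left_le)
    then have nonneg: "0 \<le> p j * G s - p j * G (s / \<rho> j)" for j
      using p_pos[of j] by (simp add: G_mono)
    have "(\<lambda>j. p j * measure M (S j -` {x. s < h x})) sums G s"
      using ssm G_sets[of s] unfolding is_self_similar_measure_def G_def sets by blast
    from sums_diff[OF sums_mult2[OF p_sums, of "G s"] this]
    have sums0: "(\<lambda>j. p j * G s - p j * measure M (S j -` {x. s < h x})) sums 0" by simp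
    have le: "p j * G s - p j * G (s / \<rho> j) \<le> p j * G s - p j * measure M (S j -` {x. s < h x})" for j
    proof -
      have "S j -` {x. s < h x} \<subseteq> {x. s / \<rho> j < h x}"
        using h_S[of j] rho(1)[of j] by (auto simp: divide_less_eq mult.commute intro: less_le_trans)
      then have "measure M (S j -` {x. s < h x}) \<le> G (s / \<rho> j)"
        unfolding G_def by (intro finite_measure_mono G_sets)
      then show ?thesis using p_pos[of j] by simp
    qed
    \<comment> \<open>The terms of \<open>sums0\<close> are nonnegative and add up to
      \<open>0\<close>, so the one with index \<open>0\<close> is at most \<open>0\<close>.\<close>
    have "p 0 * G s - p 0 * G (s / \<rho> 0) \<le> p 0 * G s - p 0 * measure M (S 0 -` {x. s < h x})" by (rule le)
    also have "\<dots> = (\<Sum>j\<in>{0}. p j * G s - p j * measure M (S j -` {x. s < h x}))" by simp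
    also have "\<dots> \<le> (\<Sum>j. p j * G s - p j * measure M (S j -` {x. s < h x}))"
      using sums0 order_trans[OF nonneg le] by (intro sum_le_suminf) (auto simp: sums_iff)
    also have "\<dots> = 0" using sums0 by (simp add: sums_iff)
    finally have "p 0 * (G s - G (s / \<rho> 0)) \<le> 0" by (simp add: right_diff_distrib)
    then have "G s \<le> G (s / \<rho> 0)" using p_pos[of 0] by (simp add: mult_le_0_iff)
    moreover have "G (s / \<rho> 0) \<le> G s" using \<open>s \<le> s / \<rho> 0\<close> by (rule G_mono)
    ultimately show ?thesis by simp
  qed
  have G_zero: "G s = 0" if "0 < s" for s
  proof -
    have iter: "G (s / \<rho> 0 ^ n) = G s" for n
    proof (induction n)
      case (Suc n)
      have "0 < s / \<rho> 0 ^ n" using that rho(1)[of 0] by simp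
      from G_eq[OF this] Suc show ?case by (simp add: mult.commute)
    qed simp
    have mono: "s / \<rho> 0 ^ n \<le> s / \<rho> 0 ^ Suc n" for n
      using that rho[of 0] by (intro divide_left_mono) (auto simp: power_le_one mult_le_one mult_left_le_one_le)
    \<comment> \<open>The levels \<open>s / \<rho> 0 ^ n\<close> tend to infinity, so the superlevel
      sets shrink to the empty set while their measure stays \<open>G s\<close>.\<close>
    have "(\<lambda>n. G (s / \<rho> 0 ^ n)) \<longlonglongrightarrow> measure M (\<Inter>n. {x. s / \<rho> 0 ^ n < h x})"
      unfolding G_def
    proof (rule finite_Lim_measure_decseq)
      show "decseq (\<lambda>n. {x. s / \<rho> 0 ^ n < h x})"
        by (rule decseq_SucI) (use mono in \<open>auto intro: le_less_trans\<close>)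
    qed (use G_sets in auto)
    moreover have "(\<Inter>n. {x. s / \<rho> 0 ^ n < h x}) = {}"
    proof -
      have "\<exists>n. h x \<le> s / \<rho> 0 ^ n" for x
      proof -
        obtain n where "h x / s < (1 / \<rho> 0) ^ n"
          using real_arch_pow[of "1 / \<rho> 0" "h x / s"] rho[of 0] by auto
        then have "h x \<le> s / \<rho> 0 ^ n" using that by (simp add: power_one_over field_simps)
        then show ?thesis ..
      qed
      then have "\<exists>n. \<not> s / \<rho> 0 ^ n < h x" for x by (simp add: not_less)
      then show ?thesis by blast
    qed
    ultimately have "(\<lambda>n. G s) \<longlonglongrightarrow> 0" by (simp add: iter)
    then show ?thesis by (simp add: LIMSEQ_const_iff)
  qed
  have "AE x in M. h x \<le> 1 / real (Suc n)" for n
  proof (rule AE_I)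
    show "{x \<in> space M. \<not> h x \<le> 1 / real (Suc n)} \<subseteq> {x. 1 / real (Suc n) < h x}" by auto
    show "emeasure M {x. 1 / real (Suc n) < h x} = 0"
      using G_zero[of "1 / real (Suc n)"] by (simp add: emeasure_eq_measure G_def)
  qed (rule G_sets)
  then have "AE x in M. \<forall>n. h x \<le> 1 / real (Suc n)" by (simp add: AE_all_countable)
  then show ?thesis
  proof eventually_elim
    case (elim x)
    have "h x \<le> 0"
    proof (rule ccontr)
      assume "\<not> h x \<le> 0"
      then obtain n where "1 / real (Suc n) < h x" using nat_approx_posE by (metis not_le)
      with elim show False by (meson not_le)
    qed
    then have "infdist x U = 0" using h_nonneg[of x] by (simp add: h_def)
    then show ?case using in_closure_iff_infdist_zero[OF \<open>U \<noteq> {}\<close>] by blast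
  qed
qed

text \<open>Separates the pairs of equal indices, which become the renewal sum, from the remaining
  ones, which become the error term.\<close>

lemma suminf_diagonal_split:
  fixes A :: "nat \<Rightarrow> nat \<Rightarrow> ennreal"
  shows "(\<Sum>j. \<Sum>k. A j k) = (\<Sum>j. A j j) + (\<Sum>j. \<Sum>k. if j = k then 0 else A j k)"
proof -
  have "(\<Sum>k. A j k) = A j j + (\<Sum>k. if j = k then 0 else A j k)" for j
  proof -
    have "(\<Sum>k. A j k) = (\<Sum>k. (if k = j then A j k else 0) + (if j = k then 0 else A j k))"
      by (intro suminf_cong) auto
    also have "\<dots> = (\<Sum>k. if k = j then A j k else 0) + (\<Sum>k. if j = k then 0 else A j k)"
      by (rule suminf_add[symmetric]) auto
    also have "(\<Sum>k. if k = j then A j k else 0) = A j j"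
      by (subst suminf_finite[of "{j}"]) auto
    finally show ?thesis .
  qed
  then show ?thesis by (simp add: suminf_add)
qed

section \<open>Self-similar systems\<close>

locale self_similar_system =
  fixes S R :: "nat \<Rightarrow> 'a::euclidean_space \<Rightarrow> 'a" and b :: "nat \<Rightarrow> 'a" and \<rho> p :: "nat \<Rightarrow> real"
    and U :: "'a set" and \<mu> :: "'a measure"
  assumes rho_pos: "\<And>j. 0 < \<rho> j" and rho_less: "\<And>j. \<rho> j < 1"
    and R_orthogonal: "\<And>j. orthogonal_transformation (R j)"
    and S_eq: "\<And>j x. S j x = \<rho> j *\<^sub>R R j x + b j"
    and U_bounded: "bounded U" and U_nonempty: "U \<noteq> {}" and U_inv: "\<And>j. S j ` U \<subseteq> U"
    and U_disjoint: "\<And>i j. i \<noteq> j \<Longrightarrow> S i ` closure U \<inter> S j ` closure U = {}"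
    and p_pos: "\<And>j. 0 < p j" and p_sums: "p sums 1"
    and self_similar: "is_self_similar_measure S p \<mu>"
begin

sublocale prob_space \<mu>
  using self_similar by (simp add: is_self_similar_measure_def)

lemma sets_mu [measurable_cong, simp]: "sets \<mu> = sets borel"
  using self_similar by (simp add: is_self_similar_measure_def)

lemma dist_S: "dist (S j x) (S j y) = \<rho> j * dist x y"
proof -
  have "S j x - S j y = \<rho> j *\<^sub>R R j (x - y)"
    using orthogonal_transformation_linear[OF R_orthogonal[of j]] by (simp add: S_eq linear_diff scaleR_diff_right)
  then show ?thesis
    using rho_pos[of j] R_orthogonal[of j] by (simp add: dist_norm orthogonal_transformation_norm)
qed

lemma S_continuous: "continuous_on A (S j)"
  unfolding S_eq[abs_def] using orthogonal_transformation_linear[OF R_orthogonal[of j]]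
  by (intro continuous_intros linear_continuous_on) (simp add: linear_conv_bounded_linear)

lemma S_measurable [measurable]: "S j \<in> borel_measurable borel"
  by (intro borel_measurable_continuous_onI S_continuous)

section \<open>Correlation integrals and the renewal equation in the radius\<close>

definition ball_volume :: "real \<Rightarrow> real" where
  "ball_volume t = unit_ball_vol (real DIM('a)) * t ^ DIM('a)"

text \<open>The integral in \<open>V\<close> before normalisation, taken in \<open>ennreal\<close>
  so that series and integrals interchange freely.\<close>

definition F :: "real \<Rightarrow> ennreal" where
  "F t = (\<integral>\<^sup>+x. (emeasure \<mu> (ball x t))\<^sup>2 \<partial>lborel)"

definition E :: "real \<Rightarrow> ennreal" where
  "E t = (\<Sum>j. \<Sum>k. if j = k then 0 else
     ennreal (p j * p k) * (\<integral>\<^sup>+x. emeasure \<mu> (S j -` ball x t) * emeasure \<mu> (S k -` ball x t) \<partial>lborel))"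

lemma ball_measurable [measurable]: "(\<lambda>x. emeasure \<mu> (ball x t)) \<in> borel_measurable borel"
  using measurable_emeasure_vimage_ball[of \<mu> "\<lambda>x. x" t] finite_measure_axioms by (simp add: vimage_def)

lemma S_vimage_ball_measurable [measurable]: "(\<lambda>x. emeasure \<mu> (S j -` ball x t)) \<in> borel_measurable borel"
  using finite_measure_axioms by (intro measurable_emeasure_vimage_ball) auto

lemma emeasure_ball_eq: "emeasure \<mu> (ball x t) = (\<Sum>j. ennreal (p j) * emeasure \<mu> (S j -` ball x t))"
proof -
  have "(\<lambda>j. p j * measure \<mu> (S j -` ball x t)) sums measure \<mu> (ball x t)"
    using self_similar by (simp add: is_self_similar_measure_def)
  then have "(\<Sum>j. ennreal (p j * measure \<mu> (S j -` ball x t))) = ennreal (measure \<mu> (ball x t))"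
    by (intro suminf_ennreal_eq mult_nonneg_nonneg less_imp_le[OF p_pos]) auto
  then show ?thesis
    using less_imp_le[OF p_pos] by (simp add: emeasure_eq_measure ennreal_mult)
qed

lemma S_vimage_ball: "S j -` ball (S j x) t = ball x (t / \<rho> j)"
  using rho_pos[of j] by (auto simp: dist_S less_divide_eq mult.commute)

text \<open>Self-similarity inserted into both factors of the square gives a double series. In a
  diagonal term the substitution by \<open>S j\<close> contributes the volume factor
  \<open>\<rho> j ^ DIM('a)\<close> and enlarges the radius to \<open>t / \<rho> j\<close>.\<close>

lemma F_eq: "F t = (\<Sum>j. ennreal ((p j)\<^sup>2 * \<rho> j ^ DIM('a)) * F (t / \<rho> j)) + E t"
proof -
  let ?\<psi> = "\<lambda>j x. emeasure \<mu> (S j -` ball x t)"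
  have "F t = (\<integral>\<^sup>+x. (\<Sum>j. \<Sum>k. ennreal (p j * p k) * (?\<psi> j x * ?\<psi> k x)) \<partial>lborel)"
    unfolding F_def
  proof (rule nn_integral_cong)
    fix x
    let ?s = "\<Sum>j. ennreal (p j) * ?\<psi> j x"
    have "(\<Sum>j. \<Sum>k. ennreal (p j * p k) * (?\<psi> j x * ?\<psi> k x))
        = (\<Sum>j. \<Sum>k. (ennreal (p j) * ?\<psi> j x) * (ennreal (p k) * ?\<psi> k x))"
      using p_pos by (intro suminf_cong) (simp add: ennreal_mult less_imp_le mult_ac)
    also have "\<dots> = ?s * ?s" by simp
    finally show "(emeasure \<mu> (ball x t))\<^sup>2 = (\<Sum>j. \<Sum>k. ennreal (p j * p k) * (?\<psi> j x * ?\<psi> k x))"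
      by (simp add: emeasure_ball_eq power2_eq_square)
  qed
  also have "\<dots> = (\<Sum>j. \<integral>\<^sup>+x. (\<Sum>k. ennreal (p j * p k) * (?\<psi> j x * ?\<psi> k x)) \<partial>lborel)"
    by (rule nn_integral_suminf) measurable
  also have "\<dots> = (\<Sum>j. \<Sum>k. \<integral>\<^sup>+x. ennreal (p j * p k) * (?\<psi> j x * ?\<psi> k x) \<partial>lborel)"
    by (intro suminf_cong nn_integral_suminf) measurable
  also have "\<dots> = (\<Sum>j. \<Sum>k. ennreal (p j * p k) * (\<integral>\<^sup>+x. ?\<psi> j x * ?\<psi> k x \<partial>lborel))"
    by (intro suminf_cong nn_integral_cmult) measurable
  also have "\<dots> = (\<Sum>j. ennreal (p j * p j) * (\<integral>\<^sup>+x. ?\<psi> j x * ?\<psi> j x \<partial>lborel)) + E t"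
    unfolding E_def by (rule suminf_diagonal_split)
  also have "(\<Sum>j. ennreal (p j * p j) * (\<integral>\<^sup>+x. ?\<psi> j x * ?\<psi> j x \<partial>lborel))
      = (\<Sum>j. ennreal ((p j)\<^sup>2 * \<rho> j ^ DIM('a)) * F (t / \<rho> j))"
  proof (rule suminf_cong)
    fix j
    have "(\<integral>\<^sup>+x. ?\<psi> j x * ?\<psi> j x \<partial>lborel)
        = ennreal (\<rho> j ^ DIM('a)) * (\<integral>\<^sup>+x. ?\<psi> j (S j x) * ?\<psi> j (S j x) \<partial>lborel)"
      by (rule nn_integral_similarity[OF rho_pos R_orthogonal S_eq, symmetric]) measurable
    also have "(\<integral>\<^sup>+x. ?\<psi> j (S j x) * ?\<psi> j (S j x) \<partial>lborel) = F (t / \<rho> j)"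
      by (simp add: F_def S_vimage_ball power2_eq_square)
    finally have "(\<integral>\<^sup>+x. ?\<psi> j x * ?\<psi> j x \<partial>lborel) = ennreal (\<rho> j ^ DIM('a)) * F (t / \<rho> j)" .
    moreover have "ennreal ((p j)\<^sup>2 * \<rho> j ^ DIM('a)) = ennreal (p j * p j) * ennreal (\<rho> j ^ DIM('a))"
      using rho_pos[of j] by (subst ennreal_mult[symmetric]) (auto simp: power2_eq_square)
    ultimately show "ennreal (p j * p j) * (\<integral>\<^sup>+x. ?\<psi> j x * ?\<psi> j x \<partial>lborel)
        = ennreal ((p j)\<^sup>2 * \<rho> j ^ DIM('a)) * F (t / \<rho> j)"
      by (simp add: mult.assoc)
  qed
  finally show ?thesis .
qed

lemma nn_integral_ball: "0 \<le> t \<Longrightarrow> (\<integral>\<^sup>+x. emeasure \<mu> (ball x t) \<partial>lborel) = ennreal (ball_volume t)"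
  using nn_integral_emeasure_vimage_ball[of \<mu> "\<lambda>x. x" t] prob_space_axioms
  by (simp add: vimage_def ball_volume_def)

lemma F_le: assumes "0 \<le> t" shows "F t \<le> ennreal (ball_volume t)"
proof -
  have "F t \<le> (\<integral>\<^sup>+x. emeasure \<mu> (ball x t) \<partial>lborel)"
    unfolding F_def
  proof (rule nn_integral_mono)
    fix x
    show "(emeasure \<mu> (ball x t))\<^sup>2 \<le> emeasure \<mu> (ball x t)"
      using mult_left_mono[OF emeasure_le_1[of "ball x t"], of "emeasure \<mu> (ball x t)"]
      by (simp add: power2_eq_square)
  qed
  with nn_integral_ball[OF assms] show ?thesis by simp
qed

text \<open>Otherwise almost every ball of radius \<open>t\<close> would have measure
  \<open>0\<close>, although these measures integrate to the positive volume of a ball.\<close>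

lemma F_pos: assumes "0 < t" shows "0 < F t"
proof (rule ccontr)
  assume "\<not> 0 < F t"
  then have "(\<integral>\<^sup>+x. (emeasure \<mu> (ball x t))\<^sup>2 \<partial>lborel) = 0" by (simp add: F_def)
  then have "AE x in lborel. (emeasure \<mu> (ball x t))\<^sup>2 = 0" by (simp add: nn_integral_0_iff_AE)
  then have "AE x in lborel. emeasure \<mu> (ball x t) = 0" by simp
  then have "(\<integral>\<^sup>+x. emeasure \<mu> (ball x t) \<partial>lborel) = 0" by (simp add: nn_integral_0_iff_AE)
  moreover have "0 < ball_volume t" using assms by (simp add: ball_volume_def)
  ultimately show False using nn_integral_ball[of t] assms by simp
qed

lemma F_mono: "mono F"
  unfolding F_def
  by (intro monoI nn_integral_mono power_mono emeasure_mono) auto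

lemma F_finite: "F t < \<infinity>"
proof -
  have "F t \<le> F (max 0 t)" by (intro monoD[OF F_mono]) simp
  also have "\<dots> \<le> ennreal (ball_volume (max 0 t))" by (rule F_le) simp
  also have "\<dots> < \<infinity>" by simp
  finally show ?thesis .
qed

lemma E_finite: "E t < \<infinity>"
proof -
  have "E t \<le> F t" by (subst F_eq) simp
  then show ?thesis using F_finite by (rule le_less_trans)
qed

text \<open>The images of \<open>closure U\<close> are compact and disjoint, hence at positive
  distance, and passing to subsets can only increase the distance.\<close>

lemma setdist_pos: assumes "j \<noteq> k" shows "0 < setdist (S j ` U) (S k ` U)"
proof -
  have comp: "compact (S i ` closure U)" for i
    using U_bounded by (intro compact_continuous_image S_continuous) (simp add: compact_closure)
  have "setdist (S j ` closure U) (S k ` closure U) \<noteq> 0"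
    using setdist_eq_0_compact_closed[OF comp compact_imp_closed[OF comp]] U_disjoint[OF assms] U_nonempty by auto
  then have "0 < setdist (S j ` closure U) (S k ` closure U)"
    using setdist_pos_le[of "S j ` closure U" "S k ` closure U"] by linarith
  also have "\<dots> \<le> setdist (S j ` U) (S k ` closure U)"
    using U_nonempty closure_subset[of U] by (intro setdist_subset_left) auto
  also have "\<dots> \<le> setdist (S j ` U) (S k ` U)"
    using U_nonempty closure_subset[of U] by (intro setdist_subset_right) auto
  finally show ?thesis .
qed

text \<open>Since \<open>\<mu>\<close> is carried by \<open>closure U\<close>, two nonzero factors
  would place a point of each image in the same ball, hence closer to each other than
  \<open>2 * t\<close>.\<close>

lemma emeasure_vimage_ball_zero:
  assumes "2 * t \<le> setdist (S j ` U) (S k ` U)"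
  shows "emeasure \<mu> (S j -` ball x t) * emeasure \<mu> (S k -` ball x t) = 0"
proof (rule ccontr)
  assume nonzero: "\<not> ?thesis"
  have AE: "AE y in \<mu>. y \<in> closure U"
    using dist_S
    by (intro self_similar_measure_AE_closure[OF rho_pos rho_less _ U_inv U_nonempty p_pos p_sums self_similar] eq_refl)
  have "\<exists>y\<in>closure U. S i y \<in> ball x t" if "emeasure \<mu> (S i -` ball x t) \<noteq> 0" for i
  proof (rule ccontr)
    assume "\<not> ?thesis"
    with AE have "AE y in \<mu>. y \<notin> S i -` ball x t" by (auto elim!: eventually_mono)
    moreover have "S i -` ball x t \<in> sets \<mu>"
      using measurable_sets_borel[OF S_measurable, of "ball x t"] by simp
    ultimately have "emeasure \<mu> (S i -` ball x t) = 0" by (simp add: AE_iff_measurable[OF _ refl] null_setsD1 AE_iff_null_sets)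
    with that show False by simp
  qed
  with nonzero obtain y z where yz: "y \<in> closure U" "S j y \<in> ball x t" "z \<in> closure U" "S k z \<in> ball x t"
    by (metis mult_zero_left mult_zero_right)
  \<comment> \<open>By continuity the two points lie in the closures of the images of
    \<open>U\<close>, and \<open>setdist\<close> does not change under closure.\<close>
  have "S i ` closure U \<subseteq> closure (S i ` U)" for i
    by (rule image_closure_subset[OF S_continuous]) (auto simp: closure_subset)
  then have "setdist (closure (S j ` U)) (closure (S k ` U)) \<le> dist (S j y) (S k z)"
    using yz by (intro setdist_le_dist) auto
  also have "\<dots> < 2 * t"
    using yz dist_triangle[of "S j y" "S k z" x] by (simp add: dist_commute)
  finally show False using assms by simp
qed

text \<open>Pairs at distance at least \<open>2 * t\<close> drop out; for the others one factor is
  at most \<open>1\<close> and the other integrates to the volume of a ball.\<close>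

lemma E_le:
  assumes "0 \<le> t"
  shows "E t \<le> (\<Sum>j. \<Sum>k. if j \<noteq> k \<and> setdist (S j ` U) (S k ` U) < 2 * t
    then ennreal (p j * p k * ball_volume t) else 0)"
  unfolding E_def
proof (intro suminf_le)
  fix j k
  let ?I = "\<integral>\<^sup>+x. emeasure \<mu> (S j -` ball x t) * emeasure \<mu> (S k -` ball x t) \<partial>lborel"
  have "?I \<le> (if setdist (S j ` U) (S k ` U) < 2 * t then ennreal (ball_volume t) else 0)"
  proof (cases "setdist (S j ` U) (S k ` U) < 2 * t")
    case True
    have "?I \<le> (\<integral>\<^sup>+x. emeasure \<mu> (S j -` ball x t) \<partial>lborel)"
      using mult_left_mono[OF emeasure_le_1] by (intro nn_integral_mono) fastforce
    also have "\<dots> = ennreal (ball_volume t)"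
      unfolding ball_volume_def using assms prob_space_axioms
      by (intro nn_integral_emeasure_vimage_ball) auto
    finally show ?thesis using True by simp
  next
    case False
    then show ?thesis by (simp add: emeasure_vimage_ball_zero not_less)
  qed
  then have "ennreal (p j * p k) * ?I
      \<le> ennreal (p j * p k) * (if setdist (S j ` U) (S k ` U) < 2 * t then ennreal (ball_volume t) else 0)"
    by (rule mult_left_mono) simp
  also have "\<dots> = (if setdist (S j ` U) (S k ` U) < 2 * t then ennreal (p j * p k * ball_volume t) else 0)"
    using p_pos[of j] p_pos[of k] by (simp add: ennreal_mult')
  finally show "(if j = k then 0 else ennreal (p j * p k) * ?I)
      \<le> (if j \<noteq> k \<and> setdist (S j ` U) (S k ` U) < 2 * t then ennreal (p j * p k * ball_volume t) else 0)"
    by auto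
qed auto

section \<open>Passage to the logarithmic scale\<close>

definition v :: "real \<Rightarrow> real \<Rightarrow> real" where
  "v \<beta> u = exp ((real DIM('a) + \<beta>) * u) * enn2real (F (exp (- u)))"

definition e :: "real \<Rightarrow> real \<Rightarrow> real" where
  "e \<beta> u = exp ((real DIM('a) + \<beta>) * u) * enn2real (E (exp (- u)))"

text \<open>The value \<open>0\<close> on the diagonal allows one series over all pairs, enumerated
  by \<open>prod_decode\<close>.\<close>

definition pair_weight :: "nat \<times> nat \<Rightarrow> real" where
  "pair_weight = (\<lambda>(j, k). if j = k then 0 else unit_ball_vol (real DIM('a)) * (p j * p k))"

text \<open>For \<open>j \<noteq> k\<close>, the two images of \<open>U\<close> are closer than
  \<open>2 * exp (- u)\<close> exactly when \<open>u\<close> is below this value.\<close>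

definition pair_threshold :: "nat \<times> nat \<Rightarrow> real" where
  "pair_threshold = (\<lambda>(j, k). ln (2 / setdist (S j ` U) (S k ` U)))"

lemma pair_weight_nonneg: "0 \<le> pair_weight w"
  using p_pos by (auto simp: pair_weight_def less_imp_le split: prod.split)

lemma exp_ball_volume:
  "exp ((real DIM('a) + \<beta>) * u) * ball_volume (exp (- u)) = unit_ball_vol (real DIM('a)) * exp (\<beta> * u)"
  by (simp add: ball_volume_def exp_of_nat_mult[symmetric] exp_add[symmetric] algebra_simps)

lemma ball_volume_nonneg: "0 \<le> t \<Longrightarrow> 0 \<le> ball_volume t"
  by (simp add: ball_volume_def)

lemma v_pos: "0 < v \<beta> u"
  using F_pos[of "exp (- u)"] F_finite[of "exp (- u)"] by (simp add: v_def enn2real_positive_iff)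

lemma v_le: "v \<beta> u \<le> unit_ball_vol (real DIM('a)) * exp (\<beta> * u)"
proof -
  have "enn2real (F (exp (- u))) \<le> ball_volume (exp (- u))"
    by (intro enn2real_leI F_le ball_volume_nonneg) auto
  then have "v \<beta> u \<le> exp ((real DIM('a) + \<beta>) * u) * ball_volume (exp (- u))"
    unfolding v_def by (rule mult_left_mono) simp
  then show ?thesis by (simp only: exp_ball_volume)
qed

lemma v_shift: assumes "0 \<le> s" shows "exp (- (real DIM('a) + \<beta>) * s) * v \<beta> u \<le> v \<beta> (u - s)"
proof -
  have "enn2real (F (exp (- u))) \<le> enn2real (F (exp (- (u - s))))"
    using assms F_finite by (intro enn2real_mono monoD[OF F_mono]) auto
  then have "exp ((real DIM('a) + \<beta>) * (u - s)) * enn2real (F (exp (- u))) \<le> v \<beta> (u - s)"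
    unfolding v_def by (rule mult_left_mono) simp
  then show ?thesis by (simp add: v_def exp_add[symmetric] algebra_simps flip: mult.assoc)
qed

lemma v_measurable: "v \<beta> \<in> borel_measurable borel"
proof -
  have "mono (\<lambda>t. enn2real (F t))"
    using F_finite by (intro monoI enn2real_mono monoD[OF F_mono]) auto
  then have [measurable]: "(\<lambda>t. enn2real (F t)) \<in> borel_measurable borel"
    by (rule borel_measurable_mono)
  show ?thesis unfolding v_def[abs_def] by measurable
qed

text \<open>The normalising factors at \<open>t\<close> and \<open>t / \<rho> j\<close> differ by
  \<open>\<rho> j\<close> to the power \<open>DIM('a) + \<beta>\<close>. Against the volume factor
  \<open>\<rho> j ^ DIM('a)\<close> this leaves the weight \<open>\<rho> j powr (- \<beta>)\<close>,
  and division by \<open>\<rho> j\<close> becomes a shift by \<open>- ln (\<rho> j)\<close>.\<close>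

lemma v_eq: "(\<lambda>j. (p j)\<^sup>2 * \<rho> j powr (- \<beta>) * v \<beta> (u - (- ln (\<rho> j)))) sums (v \<beta> u - e \<beta> u)"
proof -
  define t where "t = exp (- u)"
  define G where "G j = (p j)\<^sup>2 * \<rho> j ^ DIM('a) * enn2real (F (t / \<rho> j))" for j
  have G_nonneg: "0 \<le> G j" for j using rho_pos[of j] by (simp add: G_def)
  have G: "ennreal (G j) = ennreal ((p j)\<^sup>2 * \<rho> j ^ DIM('a)) * F (t / \<rho> j)" for j
    using rho_pos[of j] F_finite[of "t / \<rho> j"] by (simp add: G_def ennreal_mult ennreal_enn2real)
  have F_split: "F t = (\<Sum>j. ennreal (G j)) + E t" unfolding G by (rule F_eq)
  then have fin: "(\<Sum>j. ennreal (G j)) < \<infinity>" using F_finite[of t] by (auto simp: less_top)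
  have "enn2real (F t) = enn2real (\<Sum>j. ennreal (G j)) + enn2real (E t)"
    unfolding F_split using fin E_finite[of t] by (intro enn2real_plus) auto
  moreover have "G sums enn2real (\<Sum>j. ennreal (G j))"
    using fin by (intro sums_of_suminf_ennreal G_nonneg refl) auto
  ultimately have "G sums (enn2real (F t) - enn2real (E t))" by simp
  from sums_mult[OF this, of "exp ((real DIM('a) + \<beta>) * u)"]
  have "(\<lambda>j. exp ((real DIM('a) + \<beta>) * u) * G j) sums (v \<beta> u - e \<beta> u)"
    by (simp add: v_def e_def t_def right_diff_distrib)
  also have "(\<lambda>j. exp ((real DIM('a) + \<beta>) * u) * G j) = (\<lambda>j. (p j)\<^sup>2 * \<rho> j powr (- \<beta>) * v \<beta> (u - (- ln (\<rho> j))))"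
  proof
    fix j
    have "exp (- (u + ln (\<rho> j))) = t / \<rho> j"
      using rho_pos[of j] exp_diff[of "- u" "ln (\<rho> j)"] by (simp add: t_def)
    moreover have "\<rho> j powr (- \<beta>) * exp ((real DIM('a) + \<beta>) * (u + ln (\<rho> j)))
        = exp ((real DIM('a) + \<beta>) * u) * \<rho> j ^ DIM('a)"
    proof -
      have "\<rho> j ^ DIM('a) = exp (real DIM('a) * ln (\<rho> j))" using rho_pos[of j] by (simp add: exp_of_nat_mult)
      moreover have "\<rho> j powr (- \<beta>) = exp (- \<beta> * ln (\<rho> j))" using rho_pos[of j] by (simp add: powr_def)
      ultimately show ?thesis by (simp add: exp_add[symmetric] algebra_simps)
    qed
    ultimately show "exp ((real DIM('a) + \<beta>) * u) * G j = (p j)\<^sup>2 * \<rho> j powr (- \<beta>) * v \<beta> (u - (- ln (\<rho> j)))"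
      by (simp add: v_def G_def mult_ac)
  qed
  finally show ?thesis .
qed

text \<open>Identifies the off-diagonal terms required by \<open>c_summable\<close> with those of
  the distance hypothesis, up to a constant factor.\<close>

lemma pair_weight_exp:
  assumes "j \<noteq> k"
  shows "pair_weight (j, k) * exp (\<beta> * pair_threshold (j, k))
    = unit_ball_vol (real DIM('a)) * 2 powr \<beta> * (p j * p k * setdist (S j ` U) (S k ` U) powr (- \<beta>))"
proof -
  have "exp (\<beta> * ln (2 / setdist (S j ` U) (S k ` U))) = 2 powr \<beta> * setdist (S j ` U) (S k ` U) powr (- \<beta>)"
    using setdist_pos[OF assms] by (simp add: powr_def ln_div exp_add[symmetric] algebra_simps)
  then show ?thesis using assms by (simp add: pair_weight_def pair_threshold_def)
qed

lemma summable_pairs: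
  assumes "(\<lambda>(j, k). p j * p k * setdist (S j ` U) (S k ` U) powr (- \<beta>)) summable_on {(j, k). j \<noteq> k}"
  shows "summable (\<lambda>i. pair_weight (prod_decode i) * exp (\<beta> * pair_threshold (prod_decode i)))"
proof -
  let ?f = "\<lambda>w. pair_weight w * exp (\<beta> * pair_threshold w)"
  have "(\<lambda>w. unit_ball_vol (real DIM('a)) * 2 powr \<beta> *
      (case w of (j, k) \<Rightarrow> p j * p k * setdist (S j ` U) (S k ` U) powr (- \<beta>))) summable_on {(j, k). j \<noteq> k}"
    by (rule summable_on_cmult_right[OF assms])
  also have "?this \<longleftrightarrow> ?f summable_on UNIV"
    by (rule summable_on_cong_neutral) (auto simp: pair_weight_exp, auto simp: pair_weight_def)
  finally have "?f summable_on UNIV" .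
  then have "(\<lambda>i. ?f (prod_decode i)) summable_on UNIV"
    by (subst summable_on_reindex_bij_betw[OF bij_prod_decode])
  then show ?thesis by (rule summable_on_imp_summable)
qed

lemma e_nonneg: "0 \<le> e \<beta> u" by (simp add: e_def)

lemma e_le:
  assumes "0 < \<beta>"
    and summ: "summable (\<lambda>i. pair_weight (prod_decode i) * exp (\<beta> * pair_threshold (prod_decode i)))"
  shows "e \<beta> u \<le> (\<Sum>i. if u < pair_threshold (prod_decode i) then pair_weight (prod_decode i) * exp (\<beta> * u) else 0)"
proof -
  define g where "g w = (if u < pair_threshold w then pair_weight w * exp (\<beta> * u) else 0)" for w
  have g_nonneg: "0 \<le> g w" for w using pair_weight_nonneg by (simp add: g_def)
  have g_summable: "summable (\<lambda>i. g (prod_decode i))"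
    by (rule summable_comparison_test'[OF summ, of 0])
       (use \<open>0 < \<beta>\<close> in \<open>auto simp: g_def abs_mult pair_weight_nonneg intro!: mult_left_mono\<close>)
  let ?x = "exp ((real DIM('a) + \<beta>) * u)"
  have term_eq: "ennreal ?x * (if j \<noteq> k \<and> setdist (S j ` U) (S k ` U) < 2 * exp (- u)
      then ennreal (p j * p k * ball_volume (exp (- u))) else 0) = ennreal (g (j, k))" for j k
  proof (cases "j = k")
    case False
    have "setdist (S j ` U) (S k ` U) < 2 * exp (- u) \<longleftrightarrow> exp u < 2 / setdist (S j ` U) (S k ` U)"
      using setdist_pos[OF False] by (simp add: exp_minus field_simps)
    also have "2 / setdist (S j ` U) (S k ` U) = exp (pair_threshold (j, k))"
      using setdist_pos[OF False] by (simp add: pair_threshold_def)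
    also have "exp u < exp (pair_threshold (j, k)) \<longleftrightarrow> u < pair_threshold (j, k)" by simp
    finally have iff: "setdist (S j ` U) (S k ` U) < 2 * exp (- u) \<longleftrightarrow> u < pair_threshold (j, k)" .
    have "?x * (p j * p k * ball_volume (exp (- u))) = pair_weight (j, k) * exp (\<beta> * u)"
      using False exp_ball_volume[of \<beta> u] by (simp add: pair_weight_def mult_ac)
    then show ?thesis using False iff by (simp add: g_def ennreal_mult'[symmetric])
  qed (simp add: g_def pair_weight_def)
  have "ennreal (e \<beta> u) = ennreal ?x * E (exp (- u))"
    using E_finite[of "exp (- u)"] by (simp add: e_def ennreal_mult ennreal_enn2real)
  also have "\<dots> \<le> ennreal ?x * (\<Sum>j. \<Sum>k. if j \<noteq> k \<and> setdist (S j ` U) (S k ` U) < 2 * exp (- u)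
      then ennreal (p j * p k * ball_volume (exp (- u))) else 0)"
    by (intro mult_left_mono E_le) auto
  also have "\<dots> = (\<Sum>j. \<Sum>k. ennreal (g (j, k)))"
    unfolding ennreal_suminf_cmult[symmetric] term_eq ..
  also have "\<dots> = (\<Sum>i. ennreal (g (prod_decode i)))"
    by (rule suminf_ennreal_2dimen[symmetric]) simp
  also have "\<dots> = ennreal (\<Sum>i. g (prod_decode i))"
    by (rule suminf_ennreal2[OF g_nonneg g_summable])
  finally show ?thesis
    using g_nonneg g_summable by (simp add: suminf_nonneg g_def)
qed

lemma renewal_equation_v:
  assumes "0 < \<beta>" and "(\<lambda>j. (p j)\<^sup>2 * \<rho> j powr (- \<beta>)) sums 1"
    and "summable (\<lambda>j. (p j)\<^sup>2 * \<rho> j powr (- \<beta>) * (- ln (\<rho> j)))"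
    and "(\<lambda>(j, k). p j * p k * setdist (S j ` U) (S k ` U) powr (- \<beta>)) summable_on {(j, k). j \<noteq> k}"
  shows "renewal_equation (\<lambda>j. (p j)\<^sup>2 * \<rho> j powr (- \<beta>)) (\<lambda>j. - ln (\<rho> j)) (v \<beta>) (e \<beta>)
    (\<lambda>i. pair_weight (prod_decode i)) (\<lambda>i. pair_threshold (prod_decode i))
    \<beta> (real DIM('a) + \<beta>) (unit_ball_vol (real DIM('a)))"
proof
  show "0 < (p j)\<^sup>2 * \<rho> j powr (- \<beta>)" for j using p_pos[of j] rho_pos[of j] by simp
  show "0 < - ln (\<rho> j)" for j using rho_pos[of j] rho_less[of j] by simp
qed (use assms v_pos v_measurable v_le v_shift v_eq e_nonneg pair_weight_nonneg e_le summable_pairs in auto)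

end

section \<open>Finiteness of the mean and the limit theorem\<close>

text \<open>For \<open>\<beta> \<le> 0\<close> the powers of \<open>\<rho> j\<close> are at most
  \<open>1\<close>, and \<open>p j < 1\<close> makes every term smaller than \<open>p j\<close>, so
  the series could not reach \<open>1\<close>.\<close>

lemma similarity_dimension_pos:
  fixes p \<rho> :: "nat \<Rightarrow> real"
  assumes rho: "\<And>j. 0 < \<rho> j" "\<And>j. \<rho> j < 1" and p_pos: "\<And>j. 0 < p j" and p_sums: "p sums 1"
    and m_sums: "(\<lambda>j. (p j)\<^sup>2 * \<rho> j powr (- \<beta>)) sums 1"
  shows "0 < \<beta>"
proof (rule ccontr)
  assume "\<not> 0 < \<beta>"
  have p_less: "p j < 1" for j
  proof -
    have "p j < sum p {j, Suc j}" using p_pos[of "Suc j"] by simp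
    also have "\<dots> \<le> suminf p"
      using p_sums by (intro sum_le_suminf) (auto simp: sums_iff less_imp_le p_pos)
    also have "\<dots> = 1" using p_sums by (simp add: sums_iff)
    finally show ?thesis .
  qed
  have less: "(p j)\<^sup>2 * \<rho> j powr (- \<beta>) < p j" for j
  proof -
    have "\<rho> j powr (- \<beta>) \<le> 1"
      using rho[of j] \<open>\<not> 0 < \<beta>\<close> by (intro powr_le_one_le powr_le1) auto
    then have "(p j)\<^sup>2 * \<rho> j powr (- \<beta>) \<le> (p j)\<^sup>2" by (simp add: mult_left_le)
    also have "\<dots> < p j" using p_pos[of j] p_less[of j] by (simp add: power2_eq_square)
    finally show ?thesis .
  qed
  have "(\<lambda>j. p j - (p j)\<^sup>2 * \<rho> j powr (- \<beta>)) sums 0"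
    using sums_diff[OF p_sums m_sums] by simp
  moreover from this have "0 < (\<Sum>j. p j - (p j)\<^sup>2 * \<rho> j powr (- \<beta>))"
    using less by (intro suminf_pos) (auto simp: sums_iff)
  ultimately show False by (simp add: sums_iff)
qed

text \<open>The condition on \<open>q\<close> iterates to geometric decay \<open>q (\<epsilon> ^ n) \<le> \<delta> ^ n\<close>, and \<open>- ln (\<rho> j)\<close> is
  at most \<open>ln (1 / \<epsilon>)\<close> times the number of \<open>n\<close> with \<open>\<rho> j \<le> \<epsilon> ^ n\<close>.\<close>

lemma summable_log_weights:
  fixes m \<rho> :: "nat \<Rightarrow> real"
  assumes rho: "\<And>j. 0 < \<rho> j" "\<And>j. \<rho> j < 1" and m_pos: "\<And>j. 0 < m j" and m_sums: "m sums 1"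
    and q: "\<And>l. q l = (\<Sum>\<^sub>\<infinity>j\<in>{j. \<rho> j \<le> l}. m j)"
    and eps: "0 < \<epsilon>" "\<epsilon> < 1" and delta: "0 < \<delta>" "\<delta> < 1"
    and decay: "\<And>l. 0 < l \<Longrightarrow> l \<le> 1 \<Longrightarrow> q (\<epsilon> * l) \<le> \<delta> * q l"
  shows "summable (\<lambda>j. m j * (- ln (\<rho> j)))"
proof -
  define L where "L = - ln \<epsilon>"
  have L: "0 < L" using eps by (simp add: L_def)
  have q_sums: "(\<lambda>j. if \<rho> j \<le> l then m j else 0) sums q l" for l
  proof -
    have summ: "summable (\<lambda>j. if \<rho> j \<le> l then m j else 0)"
      by (rule summable_comparison_test'[of m 0])
         (use m_sums m_pos in \<open>auto simp: sums_iff less_imp_le\<close>)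
    have "q l = (\<Sum>\<^sub>\<infinity>j. if \<rho> j \<le> l then m j else 0)"
      unfolding q by (rule infsum_cong_neutral) auto
    moreover have "(\<lambda>j. if \<rho> j \<le> l then m j else 0) summable_on UNIV"
      using summ by (subst summable_on_UNIV_nonneg_real_iff) (auto simp: less_imp_le m_pos)
    ultimately have "((\<lambda>j. if \<rho> j \<le> l then m j else 0) has_sum q l) UNIV" by (simp add: has_sum_infsum)
    then show ?thesis by (rule has_sum_imp_sums)
  qed
  have q_pow: "q (\<epsilon> ^ n) \<le> \<delta> ^ n" for n
  proof (induction n)
    case 0
    have "(\<lambda>j. if \<rho> j \<le> 1 then m j else 0) = m" using rho(2) by (auto simp: less_imp_le)
    then have "q 1 = 1" using q_sums[of 1] m_sums by (simp add: sums_unique2)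
    then show ?case by simp
  next
    case (Suc n)
    have "q (\<epsilon> ^ Suc n) \<le> \<delta> * q (\<epsilon> ^ n)" using decay[of "\<epsilon> ^ n"] eps by (simp add: power_le_one)
    also have "\<dots> \<le> \<delta> * \<delta> ^ n" using Suc delta by (intro mult_left_mono) auto
    finally show ?case by simp
  qed
  have count: "ennreal (m j * (- ln (\<rho> j))) \<le> (\<Sum>n. ennreal (L * (if \<rho> j \<le> \<epsilon> ^ n then m j else 0)))" for j
  proof -
    \<comment> \<open>The number of whole multiples of \<open>L\<close> in
      \<open>- ln (\<rho> j)\<close>. The indices \<open>0\<close> to \<open>N\<close> all satisfy
      \<open>\<rho> j \<le> \<epsilon> ^ n\<close>, and these \<open>N + 1\<close> terms make up for
      the rounding.\<close>
    define N where "N = nat \<lfloor>- ln (\<rho> j) / L\<rfloor>"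
    have nonneg: "0 \<le> - ln (\<rho> j) / L" using rho[of j] L by (simp add: divide_le_0_iff less_imp_le)
    then have N: "real N \<le> - ln (\<rho> j) / L" "- ln (\<rho> j) / L \<le> real (Suc N)"
      unfolding N_def by linarith+
    have le: "\<rho> j \<le> \<epsilon> ^ n" if "n < Suc N" for n
    proof -
      have "real n \<le> - ln (\<rho> j) / L" using that N(1) by simp
      then have "ln (\<rho> j) \<le> real n * ln \<epsilon>" using L by (simp add: L_def field_simps)
      also have "\<dots> = ln (\<epsilon> ^ n)" using eps by (simp add: ln_realpow)
      finally show ?thesis using rho[of j] eps by simp
    qed
    have "m j * (- ln (\<rho> j)) \<le> m j * (L * real (Suc N))"
      using N(2) L m_pos[of j] by (intro mult_left_mono) (simp_all add: field_simps)
    also have "\<dots> = (\<Sum>n<Suc N. L * (if \<rho> j \<le> \<epsilon> ^ n then m j else 0))"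
      using le by simp
    finally have "ennreal (m j * (- ln (\<rho> j))) \<le> ennreal (\<Sum>n<Suc N. L * (if \<rho> j \<le> \<epsilon> ^ n then m j else 0))"
      by (rule ennreal_leI)
    also have "\<dots> = (\<Sum>n<Suc N. ennreal (L * (if \<rho> j \<le> \<epsilon> ^ n then m j else 0)))"
      using L m_pos[of j] by (intro sum_ennreal[symmetric]) auto
    also have "\<dots> \<le> (\<Sum>n. ennreal (L * (if \<rho> j \<le> \<epsilon> ^ n then m j else 0)))"
      by (rule sum_le_suminf) auto
    finally show ?thesis .
  qed
  have "(\<Sum>j. ennreal (m j * (- ln (\<rho> j)))) \<le> (\<Sum>j. \<Sum>n. ennreal (L * (if \<rho> j \<le> \<epsilon> ^ n then m j else 0)))"
    by (intro suminf_le count) auto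
  \<comment> \<open>The outer series is read as an integral over counting measure in order to
    exchange the two summations.\<close>
  also have "\<dots> = (\<integral>\<^sup>+j. (\<Sum>n. ennreal (L * (if \<rho> j \<le> \<epsilon> ^ n then m j else 0))) \<partial>count_space UNIV)"
    by (simp add: nn_integral_count_space_nat)
  also have "\<dots> = (\<Sum>n. \<integral>\<^sup>+j. ennreal (L * (if \<rho> j \<le> \<epsilon> ^ n then m j else 0)) \<partial>count_space UNIV)"
    by (rule nn_integral_suminf) simp
  also have "\<dots> = (\<Sum>n. \<Sum>j. ennreal (L * (if \<rho> j \<le> \<epsilon> ^ n then m j else 0)))"
    by (simp add: nn_integral_count_space_nat)
  also have "\<dots> \<le> (\<Sum>n. ennreal (L * \<delta> ^ n))"
  proof (rule suminf_le)
    fix n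
    have "(\<Sum>j. ennreal (L * (if \<rho> j \<le> \<epsilon> ^ n then m j else 0))) = ennreal (L * q (\<epsilon> ^ n))"
      using L m_pos by (intro suminf_ennreal_eq sums_mult q_sums) (auto simp: less_imp_le)
    also have "\<dots> \<le> ennreal (L * \<delta> ^ n)" using q_pow L by (intro ennreal_leI mult_left_mono) auto
    finally show "(\<Sum>j. ennreal (L * (if \<rho> j \<le> \<epsilon> ^ n then m j else 0))) \<le> ennreal (L * \<delta> ^ n)" .
  qed auto
  also have "\<dots> = ennreal (L * (1 / (1 - \<delta>)))"
    using L delta by (intro suminf_ennreal_eq sums_mult geometric_sums) auto
  also have "\<dots> < \<infinity>" by simp
  finally have "(\<Sum>j. ennreal (m j * (- ln (\<rho> j)))) \<noteq> \<infinity>" by simp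
  moreover have "0 \<le> m j * (- ln (\<rho> j))" for j
    using rho[of j] m_pos[of j] by (intro mult_nonneg_nonneg) auto
  ultimately show ?thesis by (intro summable_suminf_not_top) auto
qed

lemma V_eq_v:
  fixes \<mu> :: "(real ^ 'n) measure"
  assumes "self_similar_system S R b \<rho> p U \<mu>" and "0 < t"
  shows "V \<beta> t \<mu> = self_similar_system.v \<mu> \<beta> (- ln t)"
proof -
  interpret self_similar_system S R b \<rho> p U \<mu> by fact
  have meas: "(\<lambda>x. \<bar>measure \<mu> (ball x t)\<bar>\<^sup>2) \<in> borel_measurable borel"
    unfolding measure_def by measurable
  have "(\<integral>x. \<bar>measure \<mu> (ball x t)\<bar>\<^sup>2 \<partial>lborel) = enn2real (\<integral>\<^sup>+x. ennreal (\<bar>measure \<mu> (ball x t)\<bar>\<^sup>2) \<partial>lborel)"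
    using meas by (intro integral_eq_nn_integral) auto
  also have "(\<integral>\<^sup>+x. ennreal (\<bar>measure \<mu> (ball x t)\<bar>\<^sup>2) \<partial>lborel) = F t"
    unfolding F_def by (simp add: emeasure_eq_measure ennreal_power)
  finally have "(\<integral>x. \<bar>measure \<mu> (ball x t)\<bar>\<^sup>2 \<partial>lborel) = enn2real (F t)" .
  then show ?thesis
    using \<open>0 < t\<close> by (simp add: V_def v_def powr_def exp_minus divide_inverse mult.commute)
qed

theorem theorem3:
  fixes S :: "nat \<Rightarrow> real ^ 'n \<Rightarrow> real ^ 'n"
    and R :: "nat \<Rightarrow> real ^ 'n \<Rightarrow> real ^ 'n"
    and b :: "nat \<Rightarrow> real ^ 'n"
    and \<rho> p :: "nat \<Rightarrow> real"
    and K U :: "(real ^ 'n) set"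
    and \<mu> :: "(real ^ 'n) measure"
    and \<beta> \<epsilon> \<delta> :: real
    and q :: "real \<Rightarrow> real"
  assumes "\<And>j. 0 < \<rho> j" and "\<And>j. \<rho> j < 1"
    and "\<And>j. orthogonal_transformation (R j)"
    and "\<And>j x. S j x = \<rho> j *\<^sub>R R j x + b j"
    and "is_self_similar_set S K"
    and "strong_open_set_condition S K U"
    and "\<And>j. 0 < p j" and "p sums 1"
    and "is_self_similar_measure S p \<mu>"
    and "(\<lambda>j. (p j)\<^sup>2 * \<rho> j powr (- \<beta>)) sums 1"
    and "(\<lambda>(j, k). p j * p k * setdist (S j ` U) (S k ` U) powr (- \<beta>))
           summable_on {(j, k). j \<noteq> k}"
    and "\<And>l. q l = (\<Sum>\<^sub>\<infinity>j\<in>{j. \<rho> j \<le> l}. (p j)\<^sup>2 * \<rho> j powr (- \<beta>))"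
    and "0 < \<epsilon>" and "\<epsilon> < 1" and "0 < \<delta>" and "\<delta> < 1"
    and "\<And>l. 0 < l \<Longrightarrow> l \<le> 1 \<Longrightarrow> q (\<epsilon> * l) \<le> \<delta> * q l"
  shows "\<exists>P :: real \<Rightarrow> real.
    (\<forall>t>0. P t > 0) \<and>
    ((\<lambda>t. V \<beta> t \<mu> - P t) \<longlongrightarrow> 0) (at_right 0) \<and>
    (\<not> arithmetic (range (\<lambda>j. - ln (\<rho> j))) \<longrightarrow> (\<exists>c'. \<forall>t>0. P t = c')) \<and>
    (arithmetic (range (\<lambda>j. - ln (\<rho> j))) \<longrightarrow>
       (\<exists>r>1. group_closure (range (\<lambda>j. - ln (\<rho> j))) = range (\<lambda>m::int. ln r * of_int m) \<and>
              (\<forall>t>0. P (r * t) = P t)))"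
proof -
  \<comment> \<open>That \<open>U\<close> is nonempty follows from its meeting
    \<open>K\<close>.\<close>
  have system: "self_similar_system S R b \<rho> p U \<mu>"
    using assms(1-9) by unfold_locales (auto simp: strong_open_set_condition_def)
  interpret self_similar_system S R b \<rho> p U \<mu> by (rule system)
  have "0 < \<beta>" by (rule similarity_dimension_pos[OF assms(1,2,7,8,10)])
  have m_pos: "0 < (p j)\<^sup>2 * \<rho> j powr (- \<beta>)" for j using assms(1,7)[of j] by simp
  have "summable (\<lambda>j. (p j)\<^sup>2 * \<rho> j powr (- \<beta>) * (- ln (\<rho> j)))"
    by (rule summable_log_weights[OF assms(1,2) m_pos assms(10,12-17)])
  then obtain Q where Q_pos: "\<And>u. 0 < Q u" and Q_lim: "((\<lambda>u. v \<beta> u - Q u) \<longlongrightarrow> 0) at_top"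
    and Q_const: "\<not> arithmetic (range (\<lambda>j. - ln (\<rho> j))) \<Longrightarrow> \<exists>c'. \<forall>u. Q u = c'"
    and Q_periodic: "arithmetic (range (\<lambda>j. - ln (\<rho> j))) \<Longrightarrow>
      \<exists>h>0. group_closure (range (\<lambda>j. - ln (\<rho> j))) = range (\<lambda>n::int. h * of_int n) \<and> (\<forall>u. Q (u + h) = Q u)"
    using renewal_equation.renewal_theorem[OF renewal_equation_v[OF \<open>0 < \<beta>\<close> assms(10) _ assms(11)]] by blast
  define P where "P t = Q (- ln t)" for t
  \<comment> \<open>The substitution \<open>u = - ln t\<close> turns the limit at \<open>0\<close>
    from the right into the limit at infinity.\<close>
  have "filterlim (\<lambda>t. - ln t) at_top (at_right (0::real))"
    using ln_at_0 by (simp add: filterlim_uminus_at_bot)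
  with Q_lim have "((\<lambda>t. v \<beta> (- ln t) - Q (- ln t)) \<longlongrightarrow> 0) (at_right 0)" by (rule filterlim_compose)
  moreover have "\<forall>\<^sub>F t in at_right 0. V \<beta> t \<mu> - P t = v \<beta> (- ln t) - Q (- ln t)"
    using eventually_at_right_less[of 0] by eventually_elim (simp add: V_eq_v[OF system] P_def)
  ultimately have lim: "((\<lambda>t. V \<beta> t \<mu> - P t) \<longlongrightarrow> 0) (at_right 0)"
    by (simp add: tendsto_cong)
  \<comment> \<open>The additive period \<open>h\<close> of \<open>Q\<close> becomes the
    multiplicative period \<open>r = exp h\<close> of \<open>P\<close>, and \<open>ln r = h\<close>
    generates the lattice.\<close>
  have "\<exists>r>1. group_closure (range (\<lambda>j. - ln (\<rho> j))) = range (\<lambda>m::int. ln r * of_int m) \<and> (\<forall>t>0. P (r * t) = P t)"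
    if arith: "arithmetic (range (\<lambda>j. - ln (\<rho> j)))"
  proof -
    obtain h where h: "0 < h" "group_closure (range (\<lambda>j. - ln (\<rho> j))) = range (\<lambda>n::int. h * of_int n)"
      "\<And>u. Q (u + h) = Q u"
      using Q_periodic[OF arith] by blast
    have "P (exp h * t) = P t" if "0 < t" for t
    proof -
      have "- ln (exp h * t) = - ln t - h" using that by (simp add: ln_mult)
      then show ?thesis using h(3)[of "- ln t - h"] by (simp add: P_def)
    qed
    with h show ?thesis by (intro exI[of _ "exp h"]) simp
  qed
  moreover have "\<exists>c'. \<forall>t>0. P t = c'" if "\<not> arithmetic (range (\<lambda>j. - ln (\<rho> j)))"
    using Q_const[OF that] by (auto simp: P_def)
  ultimately show ?thesis using lim Q_pos by (intro exI[of _ P]) (simp add: P_def)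
qed

end
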